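(* Let $k\ge 2$ and $n\ge 20k^2$ be integers. Let $T_n$ be a tree on $n$ vertices with maximum degree $\Delta(T_n)<n-k$. Then $$r(T_n,P_k)=n+\lfloor k/2\rfloor-1.$$
   Context: All graphs are finite and simple. For graphs $H_1,H_2$, the Ramsey number $r(H_1,H_2)$ is the smallest positive integer $N$ such that every graph $\Gamma$ on $N$ vertices contains $H_1$ as a (not necessarily induced) subgraph or its complement $\overline{\Gamma}$ contains $H_2$ as a subgraph. $P_k$ is the path on $k$ vertices. *)

theory Defs
  imports Graph_Theory.Graph_Theory "HOL-Library.Ramsey"
begin

text \<open>
  A finite simple graph is a \<open>pair_graph\<close>: finite, and with a symmetric, loop-free set of arcs,
  each undirected edge being the two arcs \<open>(u,v)\<close> and \<open>(v,u)\<close>.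
\<close>

definition complement_graph :: "'a pair_pre_digraph \<Rightarrow> 'a pair_pre_digraph" where
  "complement_graph G = \<lparr> pverts = pverts G,
     parcs = {(u, v). u \<in> pverts G \<and> v \<in> pverts G \<and> u \<noteq> v \<and> (u, v) \<notin> parcs G} \<rparr>"

definition path_graph :: "nat \<Rightarrow> nat pair_pre_digraph" where
  "path_graph k = \<lparr> pverts = {..<k},
     parcs = {(i, j). i < k \<and> j < k \<and> (j = Suc i \<or> i = Suc j)} \<rparr>"

text \<open>
  The library's \<open>tree\<close> and \<open>forest\<close> exclude all directed cycles, including the closed
  walk \<open>u, v, u\<close>, which every edge of a symmetric digraph yields. The cycles of an undirected
  graph are the library's cycles of length at least 3. The library's \<open>connected\<close>
  includes that there is at least one vertex.
\<close>
definition tree_graph :: "'a pair_pre_digraph \<Rightarrow> bool" where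
  "tree_graph G \<longleftrightarrow> pair_graph G \<and> connected (with_proj G) \<and>
     \<not> (\<exists>p. pre_digraph.cycle (with_proj G) p \<and> 3 \<le> length p)"

text \<open>Every edge at a vertex \<open>v\<close> contributes exactly one arc leaving \<open>v\<close>.\<close>
definition max_degree :: "'a pair_pre_digraph \<Rightarrow> nat" where
  "max_degree G = Max (out_degree (with_proj G) ` pverts G)"

definition contains_subgraph :: "'a pair_pre_digraph \<Rightarrow> 'b pair_pre_digraph \<Rightarrow> bool" where
  "contains_subgraph G H \<longleftrightarrow>
     (\<exists>K :: 'a pair_pre_digraph. subgraph (with_proj K) (with_proj G) \<and>
        digraph_iso (with_proj H) (with_proj K))"

text \<open>
  Vertex type \<open>nat\<close> is no restriction on \<open>\<Gamma>\<close>, since every finite graph has an isomorphic copy there.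
\<close>
definition ramsey_property :: "'a pair_pre_digraph \<Rightarrow> 'b pair_pre_digraph \<Rightarrow> nat \<Rightarrow> bool" where
  "ramsey_property H1 H2 N \<longleftrightarrow>
     (\<forall>\<Gamma> :: nat pair_pre_digraph. pair_graph \<Gamma> \<and> card (pverts \<Gamma>) = N \<longrightarrow>
        contains_subgraph \<Gamma> H1 \<or> contains_subgraph (complement_graph \<Gamma>) H2)"

definition ramsey_number :: "'a pair_pre_digraph \<Rightarrow> 'b pair_pre_digraph \<Rightarrow> nat" where
  "ramsey_number H1 H2 = (LEAST N. 0 < N \<and> ramsey_property H1 H2 N)"

lemma contains_subgraph_iff_embedding:
  assumes G: "pair_wf_digraph G" and H: "pair_wf_digraph H"
  shows "contains_subgraph G H \<longleftrightarrow>
    (\<exists>f. inj_on f (pverts H) \<and> f ` pverts H \<subseteq> pverts G \<and>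
       (\<forall>u v. (u, v) \<in> parcs H \<longrightarrow> (f u, f v) \<in> parcs G))" (is "_ \<longleftrightarrow> ?R")
proof
  assume "contains_subgraph G H"
  then obtain K h where K: "subgraph (with_proj K) (with_proj G)"
    and h: "pre_digraph.digraph_isomorphism (with_proj H) h"
    and e: "with_proj K = app_iso h (with_proj H)"
    unfolding contains_subgraph_def digraph_iso_def by blast
  have eq: "pverts K = iso_verts h ` pverts H" "parcs K = iso_arcs h ` parcs H"
    "iso_tail h = fst" "iso_head h = snd"
    using e by (auto simp: with_proj_def app_iso_def)
  have sub: "pverts K \<subseteq> pverts G" "parcs K \<subseteq> parcs G"
    using K by (auto simp: subgraph_def)
  have inj: "inj_on (iso_verts h) (pverts H)"
    and arcs: "\<And>a. a \<in> parcs H \<Longrightarrow> iso_verts h (fst a) = fst (iso_arcs h a)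
      \<and> iso_verts h (snd a) = snd (iso_arcs h a)"
    using h eq by (auto simp: pre_digraph.digraph_isomorphism_def)
  have "(iso_verts h u, iso_verts h v) \<in> parcs G" if "(u, v) \<in> parcs H" for u v
  proof -
    have "iso_arcs h (u, v) = (iso_verts h u, iso_verts h v)"
      using arcs[OF that] by (simp add: prod_eq_iff)
    then show ?thesis using that eq sub by (metis image_eqI subsetD)
  qed
  then show ?R using inj eq sub by blast
next
  assume ?R
  then obtain f where inj: "inj_on f (pverts H)" and V: "f ` pverts H \<subseteq> pverts G"
    and E: "\<And>u v. (u, v) \<in> parcs H \<Longrightarrow> (f u, f v) \<in> parcs G" by blast
  define K where "K = \<lparr> pverts = f ` pverts H, parcs = map_prod f f ` parcs H \<rparr>"
  define h where "h = \<lparr> iso_verts = f, iso_arcs = map_prod f f, iso_head = snd, iso_tail = fst \<rparr>"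
  have wH: "\<And>u v. (u, v) \<in> parcs H \<Longrightarrow> u \<in> pverts H \<and> v \<in> pverts H"
    using H by (auto simp: pair_wf_digraph_def)
  have "pair_wf_digraph K" using wH by (auto simp: K_def pair_wf_digraph_def)
  then have "subgraph (with_proj K) (with_proj G)"
    using G V E by (auto simp: subgraph_def compatible_def wf_digraph_wp_iff K_def)
  moreover have "inj_on (map_prod f f) (parcs H)"
  proof (rule inj_on_subset[OF map_prod_inj_on[OF inj inj]])
    show "parcs H \<subseteq> pverts H \<times> pverts H" using wH by auto
  qed
  then have "pre_digraph.digraph_isomorphism (with_proj H) h"
    using inj H by (auto simp: pre_digraph.digraph_isomorphism_def wf_digraph_wp_iff h_def)
  moreover have "with_proj K = app_iso h (with_proj H)"
    by (simp add: with_proj_def app_iso_def h_def K_def)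
  ultimately show "contains_subgraph G H"
    unfolding contains_subgraph_def digraph_iso_def by blast
qed

text \<open>By Ramsey's theorem the minimum in the definition of \<open>ramsey_number\<close> exists.\<close>
lemma ramsey_property_exists:
  assumes H1: "pair_graph H1" and H2: "pair_graph H2"
  shows "\<exists>N>0. ramsey_property H1 H2 N"
proof -
  let ?m = "card (pverts H1)" and ?n = "card (pverts H2)"
  obtain r where r: "r \<ge> 1" and r_all: "\<forall>(V :: nat set) E. finite V \<and> card V \<ge> r \<longrightarrow>
      (\<exists>R\<subseteq>V. card R = ?m \<and> clique R E \<or> card R = ?n \<and> indep R E)"
    using ramsey2[where 'a = nat, of ?m ?n] by (elim exE conjE) (rule that)
  have R: "\<exists>R\<subseteq>V. card R = ?m \<and> clique R E \<or> card R = ?n \<and> indep R E"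
    if "finite V" "card V \<ge> r" for V :: "nat set" and E
    using r_all that by simp
  have wf: "pair_wf_digraph X" "finite (pverts X)" "\<And>u v. (u, v) \<in> parcs X \<Longrightarrow> u \<noteq> v"
    "\<And>u v. (u, v) \<in> parcs X \<Longrightarrow> u \<in> pverts X \<and> v \<in> pverts X"
    "\<And>u v. (u, v) \<in> parcs X \<Longrightarrow> (v, u) \<in> parcs X"
    if "pair_graph X" for X :: "'x pair_pre_digraph"
  proof -
    interpret pair_graph X by fact
    show "pair_wf_digraph X" by unfold_locales
    show "finite (pverts X)" by (rule pair_finite_verts)
    show "u \<noteq> v" if "(u, v) \<in> parcs X" for u v using pair_no_loops[OF that] by simp
    show "u \<in> pverts X \<and> v \<in> pverts X" if "(u, v) \<in> parcs X" for u v
      using wellformed'[OF that] by simp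
    show "(v, u) \<in> parcs X" if "(u, v) \<in> parcs X" for u v
      using pair_sym_arcs that by (simp add: symmetric_def symD)
  qed
  have embed: "contains_subgraph G X"
    if X: "pair_graph X" and G: "pair_wf_digraph G" and S: "S \<subseteq> pverts G" "finite S"
      and c: "card S = card (pverts X)"
      and E: "\<And>u v. u \<in> S \<Longrightarrow> v \<in> S \<Longrightarrow> u \<noteq> v \<Longrightarrow> (u, v) \<in> parcs G"
    for G :: "nat pair_pre_digraph" and S and X :: "'x pair_pre_digraph"
  proof -
    obtain f where f: "bij_betw f (pverts X) S"
      using finite_same_card_bij[OF wf(2)[OF X] S(2)] c by metis
    have "(f u, f v) \<in> parcs G" if "(u, v) \<in> parcs X" for u v
    proof (rule E)
      have uv: "u \<in> pverts X" "v \<in> pverts X" "u \<noteq> v" using wf(3,4)[OF X that] by auto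
      show "f u \<in> S" "f v \<in> S" using uv f bij_betwE by blast+
      show "f u \<noteq> f v" using uv inj_onD[OF bij_betw_imp_inj_on[OF f]] by blast
    qed
    then show ?thesis unfolding contains_subgraph_iff_embedding[OF G wf(1)[OF X]]
      using f S(1) by (auto simp: bij_betw_def intro!: exI[of _ f])
  qed
  have "ramsey_property H1 H2 r"
    unfolding ramsey_property_def
  proof (intro allI impI)
    fix G :: "nat pair_pre_digraph" assume "pair_graph G \<and> card (pverts G) = r"
    then have G: "pair_graph G" and c: "card (pverts G) = r" by auto
    define E where "E = {{u, v} |u v. (u, v) \<in> parcs G}"
    have E: "{u, v} \<in> E \<longleftrightarrow> (u, v) \<in> parcs G" for u v
      using wf(5)[OF G] by (auto simp: E_def doubleton_eq_iff)
    obtain S where S: "S \<subseteq> pverts G"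
      and d: "card S = ?m \<and> clique S E \<or> card S = ?n \<and> indep S E"
      using R[OF wf(2)[OF G] eq_imp_le[OF c[symmetric]], of E] by blast
    have fS: "finite S" using S wf(2)[OF G] finite_subset by blast
    have wC: "pair_wf_digraph (complement_graph G)"
      by (auto simp: complement_graph_def pair_wf_digraph_def)
    from d show "contains_subgraph G H1 \<or> contains_subgraph (complement_graph G) H2"
    proof
      assume m: "card S = ?m \<and> clique S E"
      have "contains_subgraph G H1"
      proof (rule embed[OF H1 wf(1)[OF G] S fS])
        show "card S = ?m" using m by simp
        show "(u, v) \<in> parcs G" if "u \<in> S" "v \<in> S" "u \<noteq> v" for u v
          using m that by (simp add: clique_def E)
      qed
      then show ?thesis ..
    next
      assume n: "card S = ?n \<and> indep S E"
      have "contains_subgraph (complement_graph G) H2"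
      proof (rule embed[OF H2 wC _ fS])
        show "S \<subseteq> pverts (complement_graph G)" using S by (simp add: complement_graph_def)
        show "card S = ?n" using n by simp
        show "(u, v) \<in> parcs (complement_graph G)" if "u \<in> S" "v \<in> S" "u \<noteq> v" for u v
          using n that S by (auto simp: indep_def E complement_graph_def)
      qed
      then show ?thesis ..
    qed
  qed
  then show ?thesis using r by (intro exI[of _ r]) auto
qed

end

theory Submission
  imports Defs
begin

text \<open>
  Write \<open>h = k div 2\<close>. For the upper bound let \<open>G\<close>, on \<open>n + h - 1\<close> vertices, have no path on \<open>k\<close>
  vertices; the tree \<open>T\<close> has to be placed on \<open>G\<close> with no edge of \<open>T\<close> on an edge of \<open>G\<close>. By the
  Erdos--Gallai bound at least three quarters of the vertices of \<open>G\<close> have degree at most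
  \<open>4 (k - 2)\<close>. A reserve \<open>J\<close> of independent vertices of degree at most 2 in \<open>T\<close> is set aside, the
  rest of \<open>T\<close> is placed greedily on vertices of low degree, and as many vertices of \<open>J\<close> as possible
  are added. If this stops early, at least \<open>h\<close> vertices of \<open>G\<close> are unused, and exchanges of
  images show that all of them are joined in \<open>G\<close> to so many common vertices that an alternating
  path on \<open>k\<close> vertices arises.

  If \<open>T\<close> has few leaves, the exchanges move the two neighbours of a vertex on a bare path. If it has
  many leaves, every unused vertex is joined to the images of all leaf parents except those that
  carry few leaves in total. For a parent \<open>c\<close> with a maximal number of leaves this is prevented by
  placing \<open>c\<close> in advance on a vertex \<open>v0\<close> all but \<open>h - 1\<close> of whose neighbours are used up by tree
  vertices not adjacent to \<open>c\<close>; that there are \<open>k\<close> such tree vertices is the hypothesis on the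
  maximum degree.
\<close>

section \<open>Graphs without long paths\<close>

definition nbhd :: "('a \<times> 'a) set \<Rightarrow> 'a \<Rightarrow> 'a set" where
  "nbhd E v = E `` {v}"

lemma in_nbhd [simp]: "u \<in> nbhd E v \<longleftrightarrow> (v, u) \<in> E"
  by (simp add: nbhd_def)

definition gpath :: "('a \<times> 'a) set \<Rightarrow> 'a list \<Rightarrow> bool" where
  "gpath E xs \<longleftrightarrow> distinct xs \<and> successively (\<lambda>u v. (u, v) \<in> E) xs"

locale simple_graph =
  fixes V :: "'a set" and E :: "('a \<times> 'a) set"
  assumes finite_V: "finite V"
    and edges_in: "(u, v) \<in> E \<Longrightarrow> u \<in> V \<and> v \<in> V"
    and edge_sym: "(u, v) \<in> E \<Longrightarrow> (v, u) \<in> E"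
    and edge_irrefl: "(v, v) \<notin> E"
begin

lemma nbhd_subset: "nbhd E v \<subseteq> V"
  using edges_in by auto

lemma finite_nbhd [simp]: "finite (nbhd E v)"
  using nbhd_subset finite_V finite_subset by blast

lemma induced: "W \<subseteq> V \<Longrightarrow> simple_graph W (E \<inter> W \<times> W)"
  using edge_sym edge_irrefl finite_V by unfold_locales (auto intro: finite_subset)

end

text \<open>Cutting the cycle just behind \<open>v\<close> leaves a path that ends in
  \<open>v\<close>. Hence every vertex of a cycle can serve as the end of an equally long
  path.\<close>

lemma cycle_rotate_path:
  assumes cyc: "gpath E cyc" and close: "(last cyc, hd cyc) \<in> E" and v: "v \<in> set cyc"
  shows "\<exists>ys. gpath E ys \<and> set ys = set cyc \<and> length ys = length cyc \<and> ys \<noteq> [] \<and> last ys = v"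
proof -
  obtain as bs where c: "cyc = as @ v # bs" using v by (meson split_list)
  have "successively (\<lambda>u v. (u, v) \<in> E) (bs @ as @ [v])"
    using cyc close unfolding c gpath_def
    by (cases as; cases bs) (auto simp: successively_append_iff successively_Cons hd_append split: if_splits)
  then show ?thesis using cyc unfolding c gpath_def
    by (intro exI[of _ "bs @ as @ [v]"]) auto
qed

lemma gpath_Cons: "gpath E (x # xs) \<longleftrightarrow>
    x \<notin> set xs \<and> gpath E xs \<and> (xs \<noteq> [] \<longrightarrow> (x, hd xs) \<in> E)"
  by (cases xs) (auto simp: gpath_def)

context simple_graph
begin

lemma gpath_rev: "gpath E xs \<Longrightarrow> gpath E (rev xs)"
  unfolding gpath_def using edge_sym
  by (auto simp: successively_rev intro: successively_mono)

text \<open>Dirac's argument on a longest path: if both of its ends have degree at least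
  \<^term>\<open>k div 2\<close>, then crossing chords close it to a cycle, whose vertex set cannot be left.\<close>
lemma low_degree_or_small_component:
  assumes nop: "\<And>xs. gpath E xs \<Longrightarrow> set xs \<subseteq> V \<Longrightarrow> length xs < k"
    and ne: "V \<noteq> {}" and k: "k \<ge> 2"
  shows "(\<exists>v\<in>V. card (nbhd E v) \<le> k div 2 - 1) \<or>
    (\<exists>X. X \<noteq> {} \<and> X \<subseteq> V \<and> (\<forall>v\<in>X. nbhd E v \<subseteq> X) \<and> card X \<le> k - 1)"
proof (rule ccontr)
  assume neg: "\<not> ?thesis"
  let ?P = "\<lambda>xs. gpath E xs \<and> set xs \<subseteq> V \<and> xs \<noteq> []"
  obtain v0 where v0: "v0 \<in> V" using ne by auto
  have "?P [v0]" using v0 by (auto simp: gpath_def)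
  moreover have "\<forall>xs. ?P xs \<longrightarrow> length xs < k" using nop by blast
  ultimately obtain xs where xs: "?P xs" and max: "\<And>ys. ?P ys \<Longrightarrow> length ys \<le> length xs"
    using ex_has_greatest_nat[of ?P "[v0]" length k] by blast
  define m where "m = length xs - 1"
  have len: "length xs = Suc m" using xs by (cases xs) (auto simp: m_def)
  have m: "m + 2 \<le> k" using nop[of xs] xs len by auto
  have dist: "distinct xs" using xs by (auto simp: gpath_def)
  \<comment> \<open>Stated for all paths of maximal length and not only for \<open>xs\<close>,
    because it is applied again to the rotations of the cycle.\<close>
  have nb_hd: "nbhd E (hd ys) \<subseteq> set ys" if "?P ys" "length ys = length xs" for ys
  proof
    fix y assume y: "y \<in> nbhd E (hd ys)"
    show "y \<in> set ys"
    proof (rule ccontr)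
      assume "y \<notin> set ys"
      then have "?P (y # ys)" using that y edge_sym edges_in by (auto simp: gpath_Cons)
      from max[OF this] that show False by simp
    qed
  qed
  have nb_last: "nbhd E (last ys) \<subseteq> set ys" if "?P ys" "length ys = length xs" for ys
    using nb_hd[of "rev ys"] that gpath_rev by (auto simp: hd_rev)
  have h0: "hd xs = xs ! 0" "last xs = xs ! m" using xs len by (auto simp: hd_conv_nth last_conv_nth)
  have inV: "hd xs \<in> V" "last xs \<in> V" using xs by auto
  \<comment> \<open>The index \<open>i\<close> stands for the edge between \<open>xs ! i\<close> and
    \<open>xs ! Suc i\<close>. Both sets lie in \<open>{..<m}\<close> and have at least
    \<open>k div 2\<close> elements; as \<open>m \<le> k - 2 < 2 * (k div 2)\<close>, they
    meet.\<close>
  define A where "A = {i. i < m \<and> (hd xs, xs ! Suc i) \<in> E}"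
  define B where "B = {i. i < m \<and> (last xs, xs ! i) \<in> E}"
  have "nbhd E (hd xs) \<subseteq> (\<lambda>i. xs ! Suc i) ` A"
  proof
    fix y assume y: "y \<in> nbhd E (hd xs)"
    then have "y \<in> set xs" using nb_hd[of xs] xs by auto
    then obtain j where j: "j < Suc m" "y = xs ! j" using len by (auto simp: in_set_conv_nth)
    have "j \<noteq> 0" using y j h0 edge_irrefl by (metis in_nbhd)
    then obtain i where "j = Suc i" by (cases j) auto
    then show "y \<in> (\<lambda>i. xs ! Suc i) ` A" using j y by (auto simp: A_def)
  qed
  then have cA: "card (nbhd E (hd xs)) \<le> card A"
    using surj_card_le[of A] by (simp add: A_def)
  have "nbhd E (last xs) \<subseteq> (\<lambda>i. xs ! i) ` B"
  proof
    fix y assume y: "y \<in> nbhd E (last xs)"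
    then have "y \<in> set xs" using nb_last[of xs] xs by auto
    then obtain j where j: "j < Suc m" "y = xs ! j" using len by (auto simp: in_set_conv_nth)
    have "j \<noteq> m" using y j h0 edge_irrefl by (metis in_nbhd)
    then show "y \<in> (\<lambda>i. xs ! i) ` B" using j y by (auto simp: B_def)
  qed
  then have cB: "card (nbhd E (last xs)) \<le> card B"
    using surj_card_le[of B] by (simp add: B_def)
  have "\<not> card (nbhd E (hd xs)) \<le> k div 2 - 1" "\<not> card (nbhd E (last xs)) \<le> k div 2 - 1"
    using neg inV by auto
  then have "card A \<ge> k div 2" "card B \<ge> k div 2" using cA cB by auto
  moreover have "card (A \<union> B) \<le> m"
    using card_mono[of "{..<m}" "A \<union> B"] by (auto simp: A_def B_def)
  moreover have "finite A" "finite B" by (auto simp: A_def B_def)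
  ultimately have "A \<inter> B \<noteq> {}"
    using card_Un_disjoint[of A B] m by fastforce
  then obtain i where i: "i < m" "(hd xs, xs ! Suc i) \<in> E" "(last xs, xs ! i) \<in> E"
    by (auto simp: A_def B_def)
  \<comment> \<open>The cycle runs along \<open>as\<close> from the first end to
    \<open>xs ! i\<close>, jumps by one chord to the last end, runs back along \<open>bs\<close> to
    \<open>xs ! Suc i\<close> and returns by the other chord.\<close>
  define as bs where "as = take (Suc i) xs" and "bs = drop (Suc i) xs"
  have asbs: "xs = as @ bs" "as \<noteq> []" "bs \<noteq> []" using i len xs by (auto simp: as_def bs_def)
  have ends: "hd as = hd xs" "last as = xs ! i" "hd bs = xs ! Suc i" "last bs = last xs"
    using asbs i len xs
    by (simp_all add: as_def bs_def hd_drop_conv_nth last_conv_nth)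
  have cyc: "gpath E (as @ rev bs)"
  proof -
    have "gpath E as" "gpath E bs" "set as \<inter> set bs = {}"
      using xs asbs(1) by (simp_all add: gpath_def successively_append_iff)
    moreover have "gpath E (rev bs)" using gpath_rev[OF \<open>gpath E bs\<close>] .
    moreover have "(last as, hd (rev bs)) \<in> E" using ends i(3) edge_sym by (simp add: hd_rev)
    ultimately show ?thesis by (simp add: gpath_def successively_append_iff)
  qed
  have close: "(last (as @ rev bs), hd (as @ rev bs)) \<in> E"
    using asbs(2,3) ends edge_sym[OF i(2)] by (simp add: last_rev)
  \<comment> \<open>A neighbour outside would lengthen the path obtained by opening the cycle at
    \<open>v\<close>.\<close>
  have closed: "nbhd E v \<subseteq> set xs" if v: "v \<in> set xs" for v
  proof -
    have "v \<in> set (as @ rev bs)" using v asbs by auto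
    from cycle_rotate_path[OF cyc close this] obtain ys where
      "gpath E ys" "set ys = set (as @ rev bs)" "length ys = length (as @ rev bs)" "ys \<noteq> []" "last ys = v"
      by auto
    then show ?thesis using nb_last[of ys] asbs xs by auto
  qed
  moreover have "card (set xs) \<le> k - 1" using dist len m by (simp add: distinct_card)
  ultimately show False using neg xs by (metis set_empty)
qed

end

text \<open>An edge at \<open>v\<close> is counted twice, once at \<open>v\<close> and once at its
  other end.\<close>

lemma (in simple_graph) sum_degree_remove:
  assumes v: "v \<in> V"
  defines "W \<equiv> V - {v}"
  shows "(\<Sum>u\<in>V. card (nbhd E u)) = (\<Sum>u\<in>W. card (nbhd (E \<inter> W \<times> W) u)) + 2 * card (nbhd E v)"
proof -
  have fW: "finite W" using finite_V by (simp add: W_def)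
  have deg: "card (nbhd E u) = card (nbhd (E \<inter> W \<times> W) u) + (if (u, v) \<in> E then 1 else 0)"
    if "u \<in> W" for u
  proof -
    have "nbhd E u = nbhd (E \<inter> W \<times> W) u \<union> (if (u, v) \<in> E then {v} else {})"
      using that edges_in by (auto simp: W_def)
    moreover have "v \<notin> nbhd (E \<inter> W \<times> W) u" by (simp add: W_def)
    moreover have "finite (nbhd (E \<inter> W \<times> W) u)"
      by (rule finite_subset[OF _ fW]) auto
    ultimately show ?thesis by simp
  qed
  have "{u \<in> W. (u, v) \<in> E} = nbhd E v"
    using edges_in edge_sym edge_irrefl by (auto simp: W_def)
  then have "(\<Sum>u\<in>W. if (u, v) \<in> E then 1 else 0) = card (nbhd E v)"
    using sum.inter_filter[OF fW, of "\<lambda>_. 1::nat" "\<lambda>u. (u, v) \<in> E"] by simp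
  then have "(\<Sum>u\<in>W. card (nbhd E u)) = (\<Sum>u\<in>W. card (nbhd (E \<inter> W \<times> W) u)) + card (nbhd E v)"
    using deg by (simp add: sum.distrib)
  then show ?thesis using finite_V v by (simp add: W_def sum.remove)
qed

text \<open>This is the Erdos-Gallai bound. Deleting a vertex of degree at most
  \<open>k div 2 - 1\<close> lowers the sum by at most \<open>k - 2\<close>; splitting off a closed
  set of at most \<open>k - 1\<close> vertices removes vertices of degree at most
  \<open>k - 2\<close> and changes no other degree.\<close>

lemma sum_degree_path_free:
  assumes "simple_graph V E" "\<And>xs. gpath E xs \<Longrightarrow> set xs \<subseteq> V \<Longrightarrow> length xs < k" "k \<ge> 2"
  shows "(\<Sum>v\<in>V. card (nbhd E v)) \<le> (k - 2) * card V"
  using assms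
proof (induction "card V" arbitrary: V E rule: less_induct)
  case less
  interpret simple_graph V E by fact
  note nop = less.prems(2)
  have IH: "(\<Sum>u\<in>W. card (nbhd (E \<inter> W \<times> W) u)) \<le> (k - 2) * card W" if W: "W \<subset> V" for W
  proof (rule less.hyps)
    show "card W < card V" using W finite_V psubset_card_mono by blast
    show "simple_graph W (E \<inter> W \<times> W)" using W induced by blast
    show "length xs < k" if "gpath (E \<inter> W \<times> W) xs" "set xs \<subseteq> W" for xs
      using that W nop[of xs] unfolding gpath_def
      by (meson IntD1 order_trans psubset_imp_subset successively_mono)
  qed (use less.prems in auto)
  show ?case
  proof (cases "V = {}")
    case False
    from low_degree_or_small_component[OF nop False less.prems(3)] show ?thesis
    proof
      assume "\<exists>v\<in>V. card (nbhd E v) \<le> k div 2 - 1"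
      then obtain v where v: "v \<in> V" "card (nbhd E v) \<le> k div 2 - 1" by auto
      have "(k - 2) * card V = (k - 2) * card (V - {v}) + (k - 2)"
        using card_Suc_Diff1[OF finite_V v(1)] by (metis mult_Suc_right add.commute)
      moreover have "V - {v} \<subset> V" using v by auto
      note IH[OF this]
      ultimately show ?thesis
        using sum_degree_remove[OF v(1)] v(2) less.prems(3) by simp
    next
      assume "\<exists>X. X \<noteq> {} \<and> X \<subseteq> V \<and> (\<forall>v\<in>X. nbhd E v \<subseteq> X) \<and> card X \<le> k - 1"
      then obtain X where X: "X \<noteq> {}" "X \<subseteq> V" "\<And>v. v \<in> X \<Longrightarrow> nbhd E v \<subseteq> X" "card X \<le> k - 1"
        by blast
      have fX: "finite X" using X finite_V finite_subset by blast
      have "card (nbhd E v) \<le> k - 2" if "v \<in> X" for v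
      proof -
        have "nbhd E v \<subseteq> X - {v}" using X(3)[OF that] edge_irrefl by auto
        then have "card (nbhd E v) \<le> card (X - {v})" using fX by (simp add: card_mono)
        then show ?thesis using that fX X(4) by simp
      qed
      then have sX: "(\<Sum>v\<in>X. card (nbhd E v)) \<le> (k - 2) * card X"
        using sum_bounded_above[of X "\<lambda>v. card (nbhd E v)" "k - 2"] by (simp add: mult.commute)
      have "nbhd E v = nbhd (E \<inter> (V - X) \<times> (V - X)) v" if "v \<in> V - X" for v
      proof -
        have "u \<notin> X" if "(v, u) \<in> E" for u
          using X(3)[of u] edge_sym[OF that] \<open>v \<in> V - X\<close> by (meson DiffD2 in_nbhd subsetD)
        then show ?thesis using that edges_in by auto
      qed
      then have "(\<Sum>v\<in>V - X. card (nbhd E v)) = (\<Sum>v\<in>V - X. card (nbhd (E \<inter> (V - X) \<times> (V - X)) v))"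
        by (intro sum.cong) auto
      also have "\<dots> \<le> (k - 2) * card (V - X)" using X by (intro IH) auto
      finally have "(\<Sum>v\<in>V. card (nbhd E v)) \<le> (k - 2) * card (V - X) + (k - 2) * card X"
        using sX sum.subset_diff[OF X(2) finite_V, of "\<lambda>v. card (nbhd E v)"] by simp
      also have "\<dots> = (k - 2) * card V"
        using card_Diff_subset[OF fX X(2)] card_mono[OF finite_V X(2)]
        by (metis add_mult_distrib2 le_add_diff_inverse2)
      finally show ?thesis .
    qed
  qed simp
qed

section \<open>Forests and greedy packing\<close>

definition indep_in :: "('a \<times> 'a) set \<Rightarrow> 'a set \<Rightarrow> bool" where
  "indep_in E I \<longleftrightarrow> (\<forall>u\<in>I. \<forall>v\<in>I. (u, v) \<notin> E)"

text \<open>Acyclicity is taken in the form of 1-degeneracy: it passes to vertex subsets and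
  supplies the vertex to delete in the inductions that follow.\<close>

locale forest_graph = simple_graph +
  assumes thin: "S \<subseteq> V \<Longrightarrow> S \<noteq> {} \<Longrightarrow> \<exists>v\<in>S. card (nbhd E v \<inter> S) \<le> 1"

lemma (in forest_graph) forest_induced:
  assumes "W \<subseteq> V" shows "forest_graph W (E \<inter> W \<times> W)"
proof -
  interpret W: simple_graph W "E \<inter> W \<times> W" by (rule induced[OF assms])
  show ?thesis
  proof
    fix S assume S: "S \<subseteq> W" "S \<noteq> {}"
    then obtain v where v: "v \<in> S" "card (nbhd E v \<inter> S) \<le> 1" using thin[of S] assms by auto
    moreover have "nbhd (E \<inter> W \<times> W) v \<inter> S = nbhd E v \<inter> S" using v S by auto
    ultimately show "\<exists>v\<in>S. card (nbhd (E \<inter> W \<times> W) v \<inter> S) \<le> 1" by metis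
  qed
qed

text \<open>Deleting a vertex of degree at most 1 costs at most 2 of the sum, and a single vertex
  has sum 0. In terms of edges, a forest has fewer edges than vertices.\<close>

lemma sum_degree_forest:
  assumes "forest_graph V E" "V \<noteq> {}"
  shows "(\<Sum>v\<in>V. card (nbhd E v)) + 2 \<le> 2 * card V"
  using assms
proof (induction "card V" arbitrary: V E rule: less_induct)
  case less
  interpret forest_graph V E by fact
  obtain v where v: "v \<in> V" "card (nbhd E v \<inter> V) \<le> 1" using thin[of V] less.prems by auto
  have d: "card (nbhd E v) \<le> 1" using v nbhd_subset[of v] by (simp add: Int_absorb2)
  show ?case
  proof (cases "V = {v}")
    case True
    then have "nbhd E v = {}" using nbhd_subset[of v] edge_irrefl by auto
    then show ?thesis using True by simp
  next
    case False
    have c: "card V = Suc (card (V - {v}))" using v finite_V by (metis card_Suc_Diff1)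
    have "(\<Sum>u\<in>V - {v}. card (nbhd (E \<inter> (V - {v}) \<times> (V - {v})) u)) + 2 \<le> 2 * card (V - {v})"
      using False v c by (intro less.hyps forest_induced) auto
    then show ?thesis using sum_degree_remove[OF v(1)] d c by simp
  qed
qed

context forest_graph
begin

text \<open>Each vertex taken into \<open>I\<close> is thin in what is left of \<open>S\<close>, so
  it discards only itself and at most one neighbour.\<close>

lemma half_independent:
  assumes "S \<subseteq> V"
  shows "\<exists>I\<subseteq>S. indep_in E I \<and> card S \<le> 2 * card I"
  using assms
proof (induction "card S" arbitrary: S rule: less_induct)
  case less
  have fS: "finite S" using less.prems finite_V finite_subset by blast
  show ?case
  proof (cases "S = {}")
    case False
    then obtain v where v: "v \<in> S" "card (nbhd E v \<inter> S) \<le> 1" using thin less.prems by blast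
    define R where "R = S - insert v (nbhd E v)"
    have "card R < card S" using v fS by (intro psubset_card_mono) (auto simp: R_def)
    then obtain I where I: "I \<subseteq> R" "indep_in E I" "card R \<le> 2 * card I"
      using less.hyps[of R] less.prems by (auto simp: R_def)
    have fI: "finite I" using I fS finite_subset by (auto simp: R_def)
    have "S = R \<union> {v} \<union> (nbhd E v \<inter> S)" using v by (auto simp: R_def)
    then have "card S \<le> card R + 1 + card (nbhd E v \<inter> S)"
      using card_Un_le[of "R \<union> {v}" "nbhd E v \<inter> S"] card_Un_le[of R "{v}"] by simp
    then have "card S \<le> 2 * card (insert v I)" using v I fI by (auto simp: R_def card_insert_if)
    moreover have "indep_in E (insert v I)"
      using I edge_sym edge_irrefl by (auto simp: indep_in_def R_def)
    moreover have "insert v I \<subseteq> S" using I(1) v(1) by (auto simp: R_def)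
    ultimately show ?thesis by blast
  next
    case True
    then show ?thesis by (intro exI[of _ "{}"]) (simp add: indep_in_def)
  qed
qed

end

text \<open>An embedding of the part of the tree on \<open>D\<close> into the complement of
  \<open>E\<close>: images of adjacent vertices are distinct, so avoiding \<open>E\<close> means
  adjacency there.\<close>

definition packs :: "('a \<times> 'a) set \<Rightarrow> ('b \<times> 'b) set \<Rightarrow> 'b set \<Rightarrow> 'a set \<Rightarrow> ('a \<Rightarrow> 'b) \<Rightarrow> bool" where
  "packs F E V D f \<longleftrightarrow> inj_on f D \<and> f ` D \<subseteq> V \<and> (\<forall>u\<in>D. \<forall>v\<in>D. (u, v) \<in> F \<longrightarrow> (f u, f v) \<notin> E)"

lemma packs_subset: "packs F E V D f \<Longrightarrow> D' \<subseteq> D \<Longrightarrow> packs F E V D' f"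
  unfolding packs_def by (meson image_mono inj_on_subset subset_iff order_trans)

lemma packs_extend:
  assumes "packs F E V D f" "x \<notin> D" "u \<in> V" "u \<notin> f ` D"
    and "\<And>y. y \<in> D \<Longrightarrow> (x, y) \<in> F \<Longrightarrow> (f y, u) \<notin> E"
    and "sym F" "sym E" "irrefl F"
  shows "packs F E V (insert x D) (f(x := u))"
proof -
  have "inj_on (f(x := u)) (insert x D)"
    using assms by (auto simp: packs_def inj_on_def)
  moreover have "(f(x := u)) ` insert x D \<subseteq> V" using assms by (auto simp: packs_def)
  moreover have "((f(x := u)) a, (f(x := u)) b) \<notin> E"
    if "a \<in> insert x D" "b \<in> insert x D" "(a, b) \<in> F" for a b
  proof (cases "a = x")
    case True
    then have "b \<noteq> x" using that assms(8) by (auto simp: irrefl_def)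
    then show ?thesis using True that assms(5)[of b] assms(7) by (auto dest: symD)
  next
    case False
    show ?thesis
    proof (cases "b = x")
      case True
      then have "(x, a) \<in> F" using that assms(6) by (auto dest: symD)
      then show ?thesis using True False that assms(5)[of a] by auto
    next
      case b: False
      then show ?thesis using False that assms(1) by (auto simp: packs_def)
    qed
  qed
  ultimately show ?thesis by (auto simp: packs_def)
qed

text \<open>A thin vertex \<open>s\<close> of \<open>S\<close> is placed last. It has at most one
  neighbour in \<open>S\<close>, whose image blocks at most \<open>d\<close> vertices; by
  \<open>cross\<close> the prescribed images of its neighbours in \<open>P\<close> block nothing in
  \<open>M\<close>. So \<open>d\<close> spare vertices suffice.\<close>

lemma greedy_packing:
  assumes T: "forest_graph VT F" and G: "simple_graph V E"
    and base: "packs F E V P f0" and P: "finite P"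
    and S: "S \<subseteq> VT" "S \<inter> P = {}"
    and M: "M \<subseteq> V" "\<And>v. v \<in> M \<Longrightarrow> card (nbhd E v) \<le> d" "M \<inter> f0 ` P = {}"
    and cross: "\<And>x p v. x \<in> S \<Longrightarrow> p \<in> P \<Longrightarrow> (x, p) \<in> F \<Longrightarrow> v \<in> M \<Longrightarrow> (f0 p, v) \<notin> E"
    and room: "card S + d \<le> card M"
  shows "\<exists>f. packs F E V (P \<union> S) f \<and> (\<forall>p\<in>P. f p = f0 p) \<and> f ` S \<subseteq> M"
  using S cross room
proof (induction "card S" arbitrary: S rule: less_induct)
  case less
  interpret T: forest_graph VT F by fact
  interpret G: simple_graph V E by fact
  have fS: "finite S" using less.prems(1) T.finite_V finite_subset by blast
  have fM: "finite M" using M G.finite_V finite_subset by blast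
  show ?case
  proof (cases "S = {}")
    case True
    then show ?thesis using base by auto
  next
    case False
    then obtain s where s: "s \<in> S" "card (nbhd F s \<inter> S) \<le> 1"
      using T.thin[OF less.prems(1)] by blast
    define R where "R = S - {s}"
    have c: "card S = Suc (card R)" using card_Suc_Diff1[OF fS s(1)] by (simp add: R_def)
    have "\<exists>f. packs F E V (P \<union> R) f \<and> (\<forall>p\<in>P. f p = f0 p) \<and> f ` R \<subseteq> M"
    proof (rule less.hyps)
      show "card R < card S" "card R + d \<le> card M" using c less.prems(4) by auto
      show "R \<subseteq> VT" "R \<inter> P = {}" using less.prems(1,2) by (auto simp: R_def)
      show "(f0 p, v) \<notin> E" if "x \<in> R" "p \<in> P" "(x, p) \<in> F" "v \<in> M" for x p v
        using less.prems(3)[of x p v] that by (simp add: R_def)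
    qed
    then obtain f where f: "packs F E V (P \<union> R) f" "\<And>p. p \<in> P \<Longrightarrow> f p = f0 p" "f ` R \<subseteq> M" by blast
    define B where "B = (\<Union>w\<in>nbhd F s \<inter> R. nbhd E (f w))"
    have eq: "nbhd F s \<inter> R = nbhd F s \<inter> S" using T.edge_irrefl by (auto simp: R_def)
    have fR: "finite R" using fS by (simp add: R_def)
    have "card B \<le> (\<Sum>w\<in>nbhd F s \<inter> R. card (nbhd E (f w)))"
      unfolding B_def by (rule card_UN_le) (simp add: fR)
    also have "\<dots> \<le> card (nbhd F s \<inter> R) * d"
      using sum_bounded_above[of "nbhd F s \<inter> R" "\<lambda>w. card (nbhd E (f w))" d] M(2) f(3) by auto
    also have "\<dots> \<le> d" using s eq by (metis mult.commute mult_le_mono2 nat_mult_1_right)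
    finally have B: "card B \<le> d" .
    have "card (f ` R \<union> B) \<le> card R + d"
      using card_Un_le[of "f ` R" B] card_image_le[OF fR, of f] B by linarith
    then have "card (f ` R \<union> B) < card M" using less.prems(4) c by simp
    then have "\<not> M \<subseteq> f ` R \<union> B"
      by (metis card_mono finite_UnI finite_imageI fR B_def finite_UN finite_Int G.finite_nbhd linorder_not_less)
    then obtain u where u: "u \<in> M" "u \<notin> f ` R" "u \<notin> B" by auto
    have "packs F E V (insert s (P \<union> R)) (f(s := u))"
    proof (rule packs_extend[OF f(1)])
      show "s \<notin> P \<union> R" using s(1) less.prems(2) by (auto simp: R_def)
      show "u \<in> V" using u M by auto
      have "u \<notin> f ` P" using u M(3) f(2) by auto
      then show "u \<notin> f ` (P \<union> R)" using u by auto
      show "(f y, u) \<notin> E" if y: "y \<in> P \<union> R" "(s, y) \<in> F" for y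
      proof (cases "y \<in> P")
        case True
        then show ?thesis using less.prems(3)[OF s(1) True y(2) u(1)] f(2) by simp
      next
        case False
        then show ?thesis using y u(3) by (auto simp: B_def)
      qed
      show "sym F" "sym E" "irrefl F"
        using T.edge_sym G.edge_sym T.edge_irrefl by (auto simp: sym_def irrefl_def)
    qed
    moreover have "insert s (P \<union> R) = P \<union> S" using s by (auto simp: R_def)
    moreover have "(f(s := u)) ` S \<subseteq> M" using f(3) u s by (auto simp: R_def)
    moreover have "\<forall>p\<in>P. (f(s := u)) p = f0 p" using f(2) s(1) less.prems(2) by auto
    ultimately show ?thesis by metis
  qed
qed

section \<open>Alternating paths\<close>

text \<open>The path is \<open>c 0, b 0, c 1, b 1, ...\<close>. It starts in \<open>c\<close>, and
  for odd \<open>k\<close> it ends there too, which is why \<open>c\<close> has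
  \<open>(k + 1) div 2\<close> terms.\<close>

lemma alternating_gpath:
  assumes b: "inj_on b {..<k div 2}" and c: "inj_on c {..<(k + 1) div 2}"
    and disj: "b ` {..<k div 2} \<inter> c ` {..<(k + 1) div 2} = {}"
    and cb: "\<And>i. i < k div 2 \<Longrightarrow> (c i, b i) \<in> E"
    and bc: "\<And>i. Suc i < (k + 1) div 2 \<Longrightarrow> (b i, c (Suc i)) \<in> E"
  shows "\<exists>xs. gpath E xs \<and> length xs = k \<and> set xs \<subseteq> b ` {..<k div 2} \<union> c ` {..<(k + 1) div 2}"
proof -
  define g where "g j = (if even j then c (j div 2) else b (j div 2))" for j
  have ev: "j div 2 < (k + 1) div 2" if "j < k" "even j" for j using that by presburger
  have od: "j div 2 < k div 2" if "j < k" "odd j" for j using that by presburger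
  have "inj_on g {..<k}"
  proof (rule inj_onI)
    fix i j assume ij: "i \<in> {..<k}" "j \<in> {..<k}" "g i = g j"
    have "even i \<longleftrightarrow> even j"
    proof (rule ccontr)
      assume "\<not> (even i \<longleftrightarrow> even j)"
      then obtain i' j' where "i' < k" "even i'" "j' < k" "odd j'" "c (i' div 2) = b (j' div 2)"
        using ij by (cases "even i") (auto simp: g_def)
      then show False using disj ev[of i'] od[of j'] by blast
    qed
    moreover have "i div 2 = j div 2"
    proof (cases "even i")
      case True
      then have "even j" using calculation by simp
      then have "c (i div 2) = c (j div 2)" using True ij(3) by (simp add: g_def)
      then show ?thesis using inj_onD[OF c] ev[of i] ev[of j] ij True \<open>even j\<close> by simp
    next
      case False
      then have "odd j" using calculation by simp
      then have "b (i div 2) = b (j div 2)" using False ij(3) by (simp add: g_def)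
      then show ?thesis using inj_onD[OF b] od[of i] od[of j] ij False \<open>odd j\<close> by simp
    qed
    ultimately show "i = j" by presburger
  qed
  then have "distinct (map g [0..<k])" by (simp add: distinct_map atLeast0LessThan)
  moreover have "(g j, g (Suc j)) \<in> E" if "Suc j < k" for j
  proof (cases "even j")
    case True
    then show ?thesis using cb[of "j div 2"] that od[of "Suc j"] by (auto simp: g_def)
  next
    case False
    then have "Suc j div 2 = Suc (j div 2)" by presburger
    then show ?thesis using bc[of "j div 2"] that ev[of "Suc j"] False by (auto simp: g_def)
  qed
  then have "successively (\<lambda>u v. (u, v) \<in> E) (map g [0..<k])"
    by (auto simp: successively_conv_nth)
  moreover have "g j \<in> b ` {..<k div 2} \<union> c ` {..<(k + 1) div 2}" if "j < k" for j
    using ev[OF that] od[OF that] by (cases "even j") (simp_all add: g_def)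
  then have "set (map g [0..<k]) \<subseteq> b ` {..<k div 2} \<union> c ` {..<(k + 1) div 2}"
    by (simp add: image_subset_iff)
  ultimately show ?thesis by (intro exI[of _ "map g [0..<k]"]) (auto simp: gpath_def)
qed

lemma ex_inj_below_card:
  assumes "finite A" "m \<le> card A"
  shows "\<exists>b. inj_on b {..<m} \<and> b ` {..<m} \<subseteq> A"
proof -
  obtain b where "bij_betw b {0..<card A} A" using ex_bij_betw_nat_finite[OF assms(1)] by blast
  then have "inj_on b {0..<card A}" "b ` {0..<card A} = A" by (auto simp: bij_betw_def)
  moreover have "{..<m} \<subseteq> {0..<card A}" using assms by auto
  ultimately show ?thesis by (metis image_mono inj_on_subset)
qed

lemma complete_bipartite_gpath:
  assumes "finite U" "finite P" "k div 2 \<le> card U" "(k + 1) div 2 \<le> card P" "U \<inter> P = {}"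
    and "\<And>u p. u \<in> U \<Longrightarrow> p \<in> P \<Longrightarrow> (u, p) \<in> E \<and> (p, u) \<in> E"
  shows "\<exists>xs. gpath E xs \<and> length xs = k \<and> set xs \<subseteq> U \<union> P"
proof -
  obtain b where b: "inj_on b {..<k div 2}" "b ` {..<k div 2} \<subseteq> U"
    using ex_inj_below_card assms by metis
  obtain c where c: "inj_on c {..<(k + 1) div 2}" "c ` {..<(k + 1) div 2} \<subseteq> P"
    using ex_inj_below_card assms by metis
  have bU: "b i \<in> U" if "i < k div 2" for i using b(2) that by blast
  have cP: "c i \<in> P" if "i < (k + 1) div 2" for i using c(2) that by blast
  obtain xs where xs: "gpath E xs" "length xs = k" "set xs \<subseteq> b ` {..<k div 2} \<union> c ` {..<(k + 1) div 2}"
  proof (atomize_elim, rule alternating_gpath[OF b(1) c(1)])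
    show "b ` {..<k div 2} \<inter> c ` {..<(k + 1) div 2} = {}" using b(2) c(2) assms(5) by blast
    show "(c i, b i) \<in> E" if "i < k div 2" for i using that bU[of i] cP[of i] assms(6) by simp
    show "(b i, c (Suc i)) \<in> E" if "Suc i < (k + 1) div 2" for i
      using that bU[of i] cP[of "Suc i"] assms(6) by simp
  qed
  have "set xs \<subseteq> U \<union> P" using xs(3) b(2) c(2) by (meson Un_mono order_trans)
  then show ?thesis using xs by blast
qed

text \<open>The sets are so large that a greedy choice never fails: fewer than \<open>m\<close>
  elements are taken when a set is reached.\<close>

lemma distinct_representatives:
  assumes "\<And>i. i < m \<Longrightarrow> finite (A i) \<and> m \<le> card (A i)"
  shows "\<exists>c. inj_on c {..<m} \<and> (\<forall>i<m. c i \<in> A i)"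
proof -
  have "\<exists>c. inj_on c {..<j} \<and> (\<forall>i<j. c i \<in> A i)" if "j \<le> m" for j
    using that
  proof (induction j)
    case (Suc j)
    then obtain c where c: "inj_on c {..<j}" "\<forall>i<j. c i \<in> A i" by auto
    have "card (c ` {..<j}) < card (A j)"
      using card_image_le[of "{..<j}" c] Suc.prems assms[of j] by simp
    then have "\<not> A j \<subseteq> c ` {..<j}" by (metis card_mono finite_imageI finite_lessThan linorder_not_less)
    then obtain y where y: "y \<in> A j" "y \<notin> c ` {..<j}" by auto
    have "inj_on (c(j := y)) {..<Suc j}" using c(1) y(2) by (auto simp: inj_on_def less_Suc_eq)
    moreover have "\<forall>i<Suc j. (c(j := y)) i \<in> A i" using c(2) y(1) by (auto simp: less_Suc_eq)
    ultimately show ?case by blast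
  qed simp
  then show ?thesis by blast
qed

text \<open>The path alternates between vertices \<open>b i\<close> of \<open>U\<close> and vertices
  of \<open>S\<close>. A vertex between two of the \<open>b i\<close> must avoid at most
  \<open>e\<close> non-neighbours of each, and the \<open>b i\<close> themselves because
  \<open>U\<close> and \<open>S\<close> may overlap. At least \<open>(k + 1) div 2\<close>
  candidates remain, enough for distinct representatives.\<close>

lemma nearly_complete_gpath:
  assumes "simple_graph V E" and fin: "finite U" "finite S"
    and U: "k div 2 \<le> card U" and k: "k \<ge> 2"
    and miss: "\<And>b. b \<in> U \<Longrightarrow> card (S - nbhd E b) \<le> e"
    and S: "2 * e + k + 1 \<le> card S"
  shows "\<exists>xs. gpath E xs \<and> length xs = k \<and> set xs \<subseteq> U \<union> S"
proof -
  interpret simple_graph V E by fact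
  obtain b where b: "inj_on b {..<k div 2}" "b ` {..<k div 2} \<subseteq> U"
    using ex_inj_below_card fin U by metis
  let ?h = "k div 2"
  \<comment> \<open>At the two ends a neighbour is repeated: \<open>i - 1\<close> is 0 for
    \<open>i = 0\<close>, and for odd \<open>k\<close> the last index \<open>k div 2\<close> is cut
    down to \<open>k div 2 - 1\<close> by \<open>min\<close>.\<close>
  define A where "A i = S - (S - nbhd E (b (min i (?h - 1)))) - (S - nbhd E (b (i - 1))) - b ` {..<?h}" for i
  have A: "finite (A i) \<and> (k + 1) div 2 \<le> card (A i)" if i: "i < (k + 1) div 2" for i
  proof -
    have "b (min i (?h - 1)) \<in> U" "b (i - 1) \<in> U" using b i k by (auto simp: image_subset_iff)
    then have m: "card (S - nbhd E (b (min i (?h - 1)))) \<le> e" "card (S - nbhd E (b (i - 1))) \<le> e"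
      using miss by auto
    have l: "card X - card Y \<le> card (X - Y)" if "finite Y" for X Y :: "'a set"
      using diff_card_le_card_Diff[OF that] .
    have "card (b ` {..<?h}) \<le> ?h" using card_image_le[of "{..<?h}" b] by simp
    then have "card S - e - e - ?h \<le> card (A i)"
      unfolding A_def
      using m l[OF finite_Diff[OF fin(2)], of S "nbhd E (b (min i (?h - 1)))"]
        l[OF finite_Diff[OF fin(2)], of "S - (S - nbhd E (b (min i (?h - 1))))" "nbhd E (b (i - 1))"]
        l[of "b ` {..<?h}" "S - (S - nbhd E (b (min i (?h - 1)))) - (S - nbhd E (b (i - 1)))",
          OF finite_imageI[OF finite_lessThan]]
      by linarith
    moreover have "finite (A i)" using fin(2) unfolding A_def by (intro finite_Diff)
    ultimately show ?thesis using S by linarith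
  qed
  obtain c where c: "inj_on c {..<(k + 1) div 2}" "\<And>i. i < (k + 1) div 2 \<Longrightarrow> c i \<in> A i"
    using distinct_representatives[of "(k + 1) div 2" A] A by blast
  have cS: "c i \<in> S" "c i \<notin> b ` {..<?h}" "(b (min i (?h - 1)), c i) \<in> E" "(b (i - 1), c i) \<in> E"
    if "i < (k + 1) div 2" for i
    using c(2)[OF that] unfolding A_def Diff_iff in_nbhd by (elim conjE; simp)+
  obtain xs where xs: "gpath E xs" "length xs = k" "set xs \<subseteq> b ` {..<?h} \<union> c ` {..<(k + 1) div 2}"
  proof (atomize_elim, rule alternating_gpath[OF b(1) c(1)])
    show "b ` {..<?h} \<inter> c ` {..<(k + 1) div 2} = {}"
    proof (rule equals0I)
      fix y assume "y \<in> b ` {..<?h} \<inter> c ` {..<(k + 1) div 2}"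
      then obtain i where i: "i < (k + 1) div 2" "y = c i" "y \<in> b ` {..<?h}" by blast
      show False using cS(2)[OF i(1)] i(2,3) by simp
    qed
    show "(c i, b i) \<in> E" if "i < ?h" for i
    proof -
      have "(b (min i (?h - 1)), c i) \<in> E" using that by (intro cS(3)) simp
      moreover have "min i (?h - 1) = i" using that by simp
      ultimately show ?thesis using edge_sym[of "b i" "c i"] by simp
    qed
    show "(b i, c (Suc i)) \<in> E" if "Suc i < (k + 1) div 2" for i
      using cS(4)[OF that] by simp
  qed
  have "c ` {..<(k + 1) div 2} \<subseteq> S"
  proof
    fix y assume "y \<in> c ` {..<(k + 1) div 2}"
    then obtain i where i: "i < (k + 1) div 2" "y = c i" by blast
    then show "y \<in> S" using cS(1)[OF i(1)] by simp
  qed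
  then have "set xs \<subseteq> U \<union> S" using xs(3) b(2) by (meson Un_mono order_trans)
  then show ?thesis using xs by blast
qed

section \<open>Trees as directed graphs\<close>

text \<open>On a longest path inside \<open>S\<close>, all neighbours in \<open>S\<close> of the
  first vertex lie on the path. One of them is not the second vertex, and the chord to it closes a
  cycle.\<close>

lemma (in simple_graph) min_degree_two_cycle:
  assumes S: "S \<subseteq> V" "S \<noteq> {}" and deg: "\<And>v. v \<in> S \<Longrightarrow> 2 \<le> card (nbhd E v \<inter> S)"
  shows "\<exists>xs. gpath E xs \<and> set xs \<subseteq> V \<and> 3 \<le> length xs \<and> (last xs, hd xs) \<in> E"
proof -
  let ?P = "\<lambda>xs. gpath E xs \<and> set xs \<subseteq> S \<and> xs \<noteq> []"
  obtain v0 where v0: "v0 \<in> S" using S by auto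
  have "?P [v0]" using v0 by (simp add: gpath_def)
  moreover have "length xs < Suc (card V)" if "?P xs" for xs
  proof -
    have "length xs = card (set xs)" using that by (simp add: gpath_def distinct_card)
    also have "\<dots> \<le> card V" using that S finite_V by (intro card_mono) auto
    finally show ?thesis by simp
  qed
  ultimately obtain xs where xs: "?P xs" and max: "\<And>ys. ?P ys \<Longrightarrow> length ys \<le> length xs"
    using ex_has_greatest_nat[of ?P "[v0]" length "Suc (card V)"] by blast
  let ?u = "hd xs"
  have u: "?u \<in> S" using xs by auto
  have nb: "y \<in> set xs" if y: "y \<in> nbhd E ?u \<inter> S" for y
  proof (rule ccontr)
    assume "y \<notin> set xs"
    then have "?P (y # xs)" using y xs edge_sym[of ?u y] by (simp add: gpath_Cons)
    from max[OF this] show False by simp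
  qed
  have "card (nbhd E ?u \<inter> S) - card {xs ! 1} \<le> card (nbhd E ?u \<inter> S - {xs ! 1})"
    by (rule diff_card_le_card_Diff) simp
  then have "card (nbhd E ?u \<inter> S - {xs ! 1}) \<ge> 1" using deg[OF u] by simp
  then obtain y where y: "y \<in> nbhd E ?u \<inter> S" "y \<noteq> xs ! 1"
    by (metis Diff_iff card.empty ex_in_conv not_one_le_zero singletonI)
  then obtain j where j: "j < length xs" "y = xs ! j" using nb by (metis in_set_conv_nth)
  have "y \<noteq> ?u" using y(1) edge_irrefl by auto
  then have "j \<noteq> 0" using j xs by (metis hd_conv_nth)
  moreover have "j \<noteq> 1" using y(2) j by auto
  ultimately have j2: "2 \<le> j" by simp
  define zs where "zs = take (Suc j) xs"
  have "xs = zs @ drop (Suc j) xs" by (simp add: zs_def)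
  then have "gpath E zs" using xs by (metis gpath_def distinct_append successively_append_iff)
  moreover have "set zs \<subseteq> V" using set_take_subset[of "Suc j" xs] xs S by (auto simp: zs_def)
  moreover have "3 \<le> length zs" using j j2 by (simp add: zs_def)
  moreover have "last zs = y" using j by (simp add: zs_def take_Suc_conv_app_nth)
  moreover have "hd zs = ?u" by (simp add: zs_def)
  moreover have "(y, ?u) \<in> E" using y(1) edge_sym by simp
  ultimately show ?thesis by metis
qed

section \<open>From the library's digraphs to edge relations\<close>

lemma pair_graph_simple_graph:
  assumes "pair_graph G" shows "simple_graph (pverts G) (parcs G)"
proof -
  interpret pair_graph G by fact
  show ?thesis
  proof
    show "finite (pverts G)" by (rule pair_finite_verts)
    show "u \<in> pverts G \<and> v \<in> pverts G" if "(u, v) \<in> parcs G" for u v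
      using wellformed'[OF that] by simp
    show "(v, u) \<in> parcs G" if "(u, v) \<in> parcs G" for u v
      using pair_sym_arcs that by (simp add: symmetric_def symD)
    show "(v, v) \<notin> parcs G" for v using pair_no_loops[of "(v, v)"] by auto
  qed
qed

text \<open>Pairing a vertex list with its shift gives the arc list of the walk through it, the form
  that the library's cycles require.\<close>

lemma pcas_zip: "pcas x (zip (x # xs) (xs @ [y])) y"
  by (induction xs arbitrary: x) auto

lemma pawalk_verts_zip: "pawalk_verts x (zip (x # xs) (xs @ [y])) = x # xs @ [y]"
  by (induction xs arbitrary: x) auto

lemma set_zip_gpath:
  "gpath E (x # xs) \<Longrightarrow> (last (x # xs), y) \<in> E \<Longrightarrow> set (zip (x # xs) (xs @ [y])) \<subseteq> E"
proof (induction xs arbitrary: x)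
  case (Cons a xs)
  then have "set (zip (a # xs) (xs @ [y])) \<subseteq> E" by (auto simp: gpath_Cons)
  then show ?case using Cons.prems by (auto simp: gpath_Cons)
qed auto

text \<open>A set in which every vertex has two neighbours gives rise to a cycle on at least 3
  vertices; read as an arc list, it is one that \<open>tree_graph\<close> excludes.\<close>

lemma tree_graph_forest:
  assumes "tree_graph T" shows "forest_graph (pverts T) (parcs T)"
proof -
  have T: "pair_graph T" using assms by (simp add: tree_graph_def)
  interpret pair_graph T by fact
  interpret simple_graph "pverts T" "parcs T" by (rule pair_graph_simple_graph[OF T])
  show ?thesis
  proof
    fix S assume S: "S \<subseteq> pverts T" "S \<noteq> {}"
    show "\<exists>v\<in>S. card (nbhd (parcs T) v \<inter> S) \<le> 1"
    proof (rule ccontr)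
      assume "\<not> ?thesis"
      then have "2 \<le> card (nbhd (parcs T) v \<inter> S)" if "v \<in> S" for v
        using that by (metis One_nat_def Suc_1 not_less_eq_eq)
      from min_degree_two_cycle[OF S this] obtain ys where
        ys: "gpath (parcs T) ys" "set ys \<subseteq> pverts T" "3 \<le> length ys" "(last ys, hd ys) \<in> parcs T"
        by blast
      obtain x xs where eq: "ys = x # xs" using ys(3) by (cases ys) auto
      let ?p = "zip (x # xs) (xs @ [x])"
      have "set ?p \<subseteq> parcs T" using set_zip_gpath[of "parcs T" x xs x] ys eq by simp
      moreover have "x \<in> pverts T" using ys(2) eq by simp
      ultimately have "awalk x ?p x" using pcas_zip[of x xs x] by (simp add: awalk_def)
      moreover have "distinct (tl (pawalk_verts x ?p))"
        using ys(1) by (simp only: pawalk_verts_zip) (simp add: gpath_def eq)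
      ultimately have "cycle ?p" unfolding cycle_def by (intro exI[of _ x]) simp
      moreover have "3 \<le> length ?p" using ys(3) eq by simp
      ultimately show False using assms unfolding tree_graph_def by blast
    qed
  qed
qed

text \<open>Connectedness as a statement about cuts: no walk leaves a set that no edge
  leaves.\<close>

lemma tree_graph_edge_leaving:
  assumes "tree_graph T" and S: "S \<subseteq> pverts T" "S \<noteq> {}" "S \<noteq> pverts T"
  shows "\<exists>u\<in>S. \<exists>v\<in>pverts T - S. (u, v) \<in> parcs T"
proof (rule ccontr)
  assume no: "\<not> ?thesis"
  have T: "pair_graph T" using assms by (simp add: tree_graph_def)
  interpret simple_graph "pverts T" "parcs T" by (rule pair_graph_simple_graph[OF T])
  obtain u v where uv: "u \<in> S" "v \<in> pverts T" "v \<notin> S" using S by auto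
  \<comment> \<open>The arcs of \<open>T\<close> are symmetric already, so symmetrization changes
    nothing and strong connectivity is reachability in \<open>T\<close>.\<close>
  have ms: "pverts (mk_symmetric (with_proj T)) = pverts T" "parcs (mk_symmetric (with_proj T)) = parcs T"
    using edge_sym by (auto simp: mk_symmetric_def)
  have "strongly_connected (with_proj (mk_symmetric (with_proj T)))"
    using assms by (simp add: tree_graph_def connected_def)
  then have "(u, v) \<in> rtrancl_on (pverts T) (parcs T)"
    using uv S unfolding strongly_connected_def reachable_def by (auto simp: ms)
  then have "u \<in> S \<longrightarrow> v \<in> S"
  proof (induction rule: rtrancl_on.induct)
    case (rtrancl_on_into_rtrancl_on a b c)
    then show ?case using no by blast
  qed simp
  then show False using uv by simp
qed

section \<open>Degrees in the tree and in the path-free graph\<close>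

text \<open>\<open>VT\<close> and \<open>F\<close> are the tree, \<open>V\<close> and
  \<open>E\<close> the graph to be avoided. Connectedness of the tree enters in the cut form
  \<open>edge_leaving\<close>.\<close>

locale packing_setting = T: forest_graph VT F + G: simple_graph V E
  for VT :: "'a set" and F and V :: "'b set" and E +
  fixes k n :: nat
  assumes k: "k \<ge> 2" and n: "n \<ge> 20 * k\<^sup>2" and card_VT: "card VT = n"
    and card_V: "card V + 1 = n + k div 2"
    and no_path: "gpath E xs \<Longrightarrow> set xs \<subseteq> V \<Longrightarrow> length xs < k"
    and edge_leaving: "S \<subseteq> VT \<Longrightarrow> S \<noteq> {} \<Longrightarrow> S \<noteq> VT \<Longrightarrow> \<exists>u\<in>S. \<exists>v\<in>VT - S. (u, v) \<in> F"
    and degree_less: "v \<in> VT \<Longrightarrow> card (nbhd F v) < n - k"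
begin

text \<open>Four times the Erdos-Gallai bound \<open>k - 2\<close> on the average degree, so that at
  most a quarter of the vertices exceed it.\<close>

definition "d = 4 * (k - 2)"

definition "low = {v \<in> V. card (nbhd E v) \<le> d}"

definition "leaves = {v \<in> VT. card (nbhd F v) = 1}"

definition "branching = {v \<in> VT. 3 \<le> card (nbhd F v)}"

text \<open>With this substitution every numerical estimate becomes linear in
  \<^term>\<open>j\<close> and \<^term>\<open>j * j\<close>.\<close>
lemma numbers: obtains j where "k = j + 2" "d = 4 * j" "20 * (j * j) + 80 * j + 80 \<le> n" "j \<le> j * j"
proof -
  obtain j where j: "k = j + 2" using k by (metis le_Suc_ex add.commute)
  have "20 * (j * j) + 80 * j + 80 \<le> n"
    using n unfolding j by (simp add: power2_eq_square algebra_simps)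
  moreover have "j \<le> j * j" by simp
  moreover have "d = 4 * j" unfolding d_def using j by simp
  ultimately show ?thesis using j that[of j] by blast
qed

lemma low_subset: "low \<subseteq> V" by (auto simp: low_def)

lemma finite_low: "finite low" using low_subset G.finite_V finite_subset by blast

text \<open>Markov's inequality for the degree sum: every vertex outside \<open>low\<close>
  contributes at least \<open>d + 1\<close>.\<close>

lemma card_low: "3 * n \<le> 4 * card low"
proof -
  let ?B = "V - low"
  have "(d + 1) * card ?B \<le> (\<Sum>v\<in>?B. card (nbhd E v))"
  proof -
    have "d + 1 \<le> card (nbhd E v)" if "v \<in> ?B" for v using that unfolding low_def by auto
    from sum_bounded_below[OF this, where A = ?B] show ?thesis by (simp add: mult.commute)
  qed
  also have "\<dots> \<le> (\<Sum>v\<in>V. card (nbhd E v))" using G.finite_V by (intro sum_mono2) auto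
  also have "\<dots> \<le> (k - 2) * card V"
    using sum_degree_path_free[OF G.simple_graph_axioms no_path k] .
  finally have *: "(d + 1) * card ?B \<le> (k - 2) * card V" .
  have "4 * card ?B \<le> card V"
  \<comment> \<open>For \<open>k = 2\<close> the factor \<open>k - 2\<close> cannot be cancelled,
    but there \<open>*\<close> itself forces \<open>card ?B = 0\<close>.\<close>
  proof (cases "k = 2")
    case True
    then show ?thesis using * by simp
  next
    case False
    have "(k - 2) * (4 * card ?B) \<le> (k - 2) * card V" using * by (simp add: d_def algebra_simps)
    then show ?thesis using False k by (metis le_antisym diff_is_0_eq mult_le_cancel1 neq0_conv)
  qed
  moreover have "card V = card low + card ?B"
    using card_Diff_subset[OF finite_low low_subset] card_mono[OF G.finite_V low_subset] by simp
  moreover have "n \<le> card V" using card_V k by linarith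
  ultimately show ?thesis by linarith
qed

lemma extend:
  assumes "packs F E V D f" "x \<notin> D" "u \<in> V" "u \<notin> f ` D"
    and "\<And>y. y \<in> D \<Longrightarrow> (x, y) \<in> F \<Longrightarrow> (f y, u) \<notin> E"
  shows "packs F E V (insert x D) (f(x := u))"
proof (rule packs_extend[OF assms])
  show "sym F" "sym E" by (auto intro: symI T.edge_sym G.edge_sym)
  show "irrefl F" by (simp add: irrefl_def T.edge_irrefl)
qed

text \<open>The vertex \<open>x\<close> gives up its image in favour of \<open>x0\<close>. The
  number of placed vertices and the set of used images stay the same, so a maximal packing remains
  maximal.\<close>

lemma exchange:
  assumes f: "packs F E V D f" and x: "x0 \<notin> D" "x \<in> D"
    and free: "\<And>y. y \<in> D \<Longrightarrow> y \<noteq> x \<Longrightarrow> (x0, y) \<in> F \<Longrightarrow> (f y, f x) \<notin> E"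
  shows "packs F E V (insert x0 (D - {x})) (f(x0 := f x))"
proof (rule extend)
  show "packs F E V (D - {x}) f" by (rule packs_subset[OF f]) auto
  show "x0 \<notin> D - {x}" "f x \<in> V" using f x by (auto simp: packs_def)
  show "f x \<notin> f ` (D - {x})" using f x by (auto simp: packs_def inj_on_def)
  show "(f y, f x) \<notin> E" if "y \<in> D - {x}" "(x0, y) \<in> F" for y using free that by auto
qed

lemma card_unused:
  assumes f: "packs F E V D f" and D: "D \<subseteq> VT" "D \<noteq> VT"
  shows "k div 2 \<le> card (V - f ` D)"
proof -
  have fD: "finite D" using D T.finite_V finite_subset by blast
  have "card D < n" using D T.finite_V card_VT by (metis psubsetI psubset_card_mono)
  moreover have "card (f ` D) = card D" using f by (simp add: packs_def card_image)
  moreover have "card (V - f ` D) = card V - card (f ` D)"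
    using f fD by (intro card_Diff_subset) (auto simp: packs_def)
  ultimately show ?thesis using card_V by linarith
qed

section \<open>Leaves and the degree excess of a tree\<close>

lemma degree_pos:
  assumes "v \<in> VT" shows "1 \<le> card (nbhd F v)"
proof -
  obtain j where j: "20 * (j * j) + 80 * j + 80 \<le> n" using numbers by metis
  have "{v} \<noteq> VT" using card_VT j by auto
  then obtain u where "(v, u) \<in> F" using edge_leaving[of "{v}"] assms by auto
  then have "nbhd F v \<noteq> {}" by auto
  then show ?thesis using T.finite_nbhd by (simp add: Suc_le_eq card_gt_0_iff)
qed

text \<open>The degrees of a forest sum to at most \<open>2 * n - 2\<close>, so all excess over
  degree 2 is paid for by the leaves, each of which falls short by 1. Truncated subtraction makes
  the leaves' own terms vanish.\<close>

lemma sum_excess: "(\<Sum>v\<in>VT. card (nbhd F v) - 2) + 2 \<le> card leaves"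
proof -
  have "card (nbhd F v) + (if v \<in> leaves then 1 else 0) = 2 + (card (nbhd F v) - 2)"
    if "v \<in> VT" for v
    using degree_pos[OF that] that by (auto simp: leaves_def)
  then have "(\<Sum>v\<in>VT. card (nbhd F v) + (if v \<in> leaves then 1 else 0)) = (\<Sum>v\<in>VT. 2 + (card (nbhd F v) - 2))"
    by (intro sum.cong) auto
  moreover have "(\<Sum>v\<in>VT. if v \<in> leaves then 1 else 0) = card leaves"
  proof -
    have "VT \<inter> leaves = leaves" by (auto simp: leaves_def)
    then show ?thesis using T.finite_V by (simp add: sum.If_cases)
  qed
  ultimately have "(\<Sum>v\<in>VT. card (nbhd F v)) + card leaves = 2 * n + (\<Sum>v\<in>VT. card (nbhd F v) - 2)"
    by (simp only: sum.distrib sum_constant card_VT) simp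
  moreover have "VT \<noteq> {}" using card_VT n k by auto
  then have "(\<Sum>v\<in>VT. card (nbhd F v)) + 2 \<le> 2 * n"
    using sum_degree_forest[OF T.forest_graph_axioms] card_VT by simp
  ultimately show ?thesis by linarith
qed

lemma sum_degree_subset:
  assumes "Y \<subseteq> VT" shows "(\<Sum>v\<in>Y. card (nbhd F v)) \<le> 2 * card Y + card leaves"
proof -
  have "(\<Sum>v\<in>Y. card (nbhd F v)) \<le> (\<Sum>v\<in>Y. 2 + (card (nbhd F v) - 2))" by (intro sum_mono) simp
  also have "\<dots> = 2 * card Y + (\<Sum>v\<in>Y. card (nbhd F v) - 2)"
    unfolding sum.distrib sum_constant by simp
  also have "(\<Sum>v\<in>Y. card (nbhd F v) - 2) \<le> (\<Sum>v\<in>VT. card (nbhd F v) - 2)"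
    using assms T.finite_V by (intro sum_mono2) auto
  finally show ?thesis using sum_excess by linarith
qed

lemma finite_branching: "finite branching" using T.finite_V by (simp add: branching_def)

lemma finite_leaves: "finite leaves" using T.finite_V by (simp add: leaves_def)

lemma card_branching: "card branching \<le> card leaves"
proof -
  have "card branching = (\<Sum>v\<in>branching. 1)" by simp
  also have "\<dots> \<le> (\<Sum>v\<in>branching. card (nbhd F v) - 2)"
    by (intro sum_mono) (auto simp: branching_def)
  also have "\<dots> \<le> (\<Sum>v\<in>VT. card (nbhd F v) - 2)"
    using T.finite_V by (intro sum_mono2) (auto simp: branching_def)
  finally show ?thesis using sum_excess by linarith
qed

lemma card_nbhds:
  assumes "Y \<subseteq> VT" shows "card (\<Union>y\<in>Y. nbhd F y) \<le> 2 * card Y + card leaves"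
proof -
  have "finite Y" using assms T.finite_V finite_subset by blast
  then have "card (\<Union>y\<in>Y. nbhd F y) \<le> (\<Sum>v\<in>Y. card (nbhd F v))" by (rule card_UN_le)
  then show ?thesis using sum_degree_subset[OF assms] by linarith
qed

lemma card_blocked:
  assumes "finite N" "f ` N \<subseteq> low"
  shows "card (\<Union>y\<in>N. nbhd E (f y)) \<le> card N * d"
proof -
  have "card (\<Union>y\<in>N. nbhd E (f y)) \<le> (\<Sum>y\<in>N. card (nbhd E (f y)))"
    by (rule card_UN_le[OF assms(1)])
  also have "\<dots> \<le> card N * d"
    using sum_bounded_above[of N "\<lambda>y. card (nbhd E (f y))" d] assms(2) by (auto simp: low_def)
  finally show ?thesis .
qed

end

section \<open>Trees with few leaves\<close>

context packing_setting
begin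

lemma relocate:
  assumes f: "packs F E V D f" and D: "D \<subseteq> VT" "p \<in> D" and b: "b \<in> V" "b \<notin> f ` D"
    and fp: "f p \<in> low" and W: "card (nbhd F p \<inter> D) \<le> 1" "f ` (nbhd F p \<inter> D) \<subseteq> low"
    and S: "S \<subseteq> V" "S \<inter> f ` branching = {}"
    and many: "3 * d + card leaves + 4 < card (S - nbhd E b)"
  shows "\<exists>f'. packs F E V D f' \<and> b \<notin> f' ` D \<and> (f' p, b) \<notin> E \<and> f' p \<in> S \<and> f' q = (if q = p then f' p else f q) \<and>
    (\<forall>x\<in>D. x = p \<or> f' x = f x \<or> f' x = f p \<and> x \<notin> branching)"
proof -
  have fD: "finite D" using D T.finite_V finite_subset by blast
  have injD: "inj_on f D" and fV: "f ` D \<subseteq> V" using f by (auto simp: packs_def)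
  \<comment> \<open>Forbidden for \<open>r\<close> are: \<open>C\<close>, which conflicts with
    placed neighbours of \<open>p\<close>; images of \<open>N\<close>, whose occupants have a
    neighbour with image joined to \<open>f p\<close> and cannot move there; images of
    \<open>W\<close>, occupied by neighbours of \<open>p\<close>. These are at most
    \<open>d\<close>, \<open>2 * d + card leaves\<close> and 1 places, with 3 more for
    \<open>f q\<close>, \<open>b\<close> and \<open>f p\<close>.\<close>
  define W where "W = nbhd F p \<inter> D"
  define Y where "Y = {y \<in> D. f y \<in> nbhd E (f p)}"
  define C where "C = (\<Union>w\<in>W. nbhd E (f w))"
  define N where "N = (\<Union>y\<in>Y. nbhd F y)"
  have fin: "finite W" "finite Y" "finite N" using fD by (simp_all add: W_def Y_def N_def)
  have cC: "card C \<le> d"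
  proof -
    have "card C \<le> card W * d" using card_blocked[of W f] fin(1) assms(8) by (simp add: C_def W_def)
    also have "\<dots> \<le> 1 * d" using assms(7) by (intro mult_right_mono) (auto simp: W_def)
    finally show ?thesis by simp
  qed
  have "inj_on f Y" by (rule inj_on_subset[OF injD]) (auto simp: Y_def)
  then have "card Y = card (f ` Y)" by (simp add: card_image)
  also have "\<dots> \<le> card (nbhd E (f p))" by (intro card_mono) (auto simp: Y_def)
  also have "\<dots> \<le> d" using fp by (simp add: low_def)
  finally have "card N \<le> 2 * d + card leaves"
    using card_nbhds[of Y] D(1) unfolding N_def Y_def by fastforce
  then have cN: "card (f ` N) \<le> 2 * d + card leaves" using card_image_le[OF fin(3), of f] by linarith
  have cW: "card (f ` W) \<le> 1" using card_image_le[OF fin(1), of f] W by (simp add: W_def)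
  have cQ: "card {f q, b, f p} \<le> 3" by (simp add: card_insert_if)
  have "card (C \<union> f ` N \<union> f ` W \<union> {f q, b, f p}) \<le> 3 * d + card leaves + 4"
    using card_Un_le[of "C \<union> f ` N \<union> f ` W" "{f q, b, f p}"] card_Un_le[of "C \<union> f ` N" "f ` W"]
      card_Un_le[of C "f ` N"] cC cN cW cQ by linarith
  moreover have "finite (C \<union> f ` N \<union> f ` W \<union> {f q, b, f p})"
    using fin by (simp add: C_def)
  ultimately have "\<not> S - nbhd E b \<subseteq> C \<union> f ` N \<union> f ` W \<union> {f q, b, f p}"
    using many by (meson card_mono le_less_trans not_le)
  then obtain r where "r \<in> S - nbhd E b" "r \<notin> C \<union> f ` N \<union> f ` W \<union> {f q, b, f p}"
    by (meson subsetI)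
  then have r: "r \<in> S" "(b, r) \<notin> E" "r \<notin> C" "r \<notin> f ` N" "r \<notin> f ` W" "r \<noteq> f q" "r \<noteq> b" "r \<noteq> f p"
    by simp_all
  have rE: "(r, b) \<notin> E" using r(2) G.edge_sym by blast
  have rV: "r \<in> V" using r S by auto
  have pW: "(f y, r) \<notin> E" if "y \<in> D" "(p, y) \<in> F" for y
    using r(3) that by (auto simp: C_def W_def)
  show ?thesis
  proof (cases "r \<in> f ` D")
    case False
    have "packs F E V (insert p (D - {p})) (f(p := r))"
    proof (rule extend)
      show "packs F E V (D - {p}) f" by (rule packs_subset[OF f]) auto
      show "r \<notin> f ` (D - {p})" using False by auto
    qed (use rV pW in auto)
    moreover have "insert p (D - {p}) = D" using D by auto
    ultimately have "packs F E V D (f(p := r))" by simp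
    moreover have "b \<notin> (f(p := r)) ` D" using b r(7) by auto
    ultimately show ?thesis using r(1) rE by (intro exI[of _ "f(p := r)"]) simp
  next
    case True
    then obtain t where t: "t \<in> D" "r = f t" by auto
    have tp: "t \<noteq> p" using r(8) t by auto
    have tW: "t \<notin> nbhd F p" using r(5) t by (auto simp: W_def)
    have tN: "t \<notin> N" using r(4) t by auto
    have tB: "t \<notin> branching" using S r(1) t(2) by blast
    define D0 where "D0 = D - {p, t}"
    have D0: "insert t (insert p D0) = D" using D t tp by (auto simp: D0_def)
    have inj: "x = y" if "x \<in> D" "y \<in> D" "f x = f y" for x y using injD that by (meson inj_onD)
    have 1: "packs F E V (insert p D0) (f(p := r))"
    proof (rule extend)
      show "packs F E V D0 f" by (rule packs_subset[OF f]) (auto simp: D0_def)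
      show "r \<notin> f ` D0" using inj[of t] t by (auto simp: D0_def)
      show "(f y, r) \<notin> E" if "y \<in> D0" "(p, y) \<in> F" for y using pW that by (auto simp: D0_def)
    qed (use rV in \<open>auto simp: D0_def\<close>)
    have "packs F E V (insert t (insert p D0)) ((f(p := r))(t := f p))"
    proof (rule extend[OF 1])
      show "t \<notin> insert p D0" using tp by (simp add: D0_def)
      show "f p \<in> V" using fV D by auto
      show "f p \<notin> (f(p := r)) ` insert p D0" using inj[of p] D r(8) by (auto simp: D0_def)
      show "((f(p := r)) y, f p) \<notin> E" if y: "y \<in> insert p D0" "(t, y) \<in> F" for y
      proof (cases "y = p")
        case True
        then show ?thesis using tW y T.edge_sym[of t p] by simp
      next
        case False
        then have yD: "y \<in> D" using y by (auto simp: D0_def)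
        show ?thesis
        proof
          assume "((f(p := r)) y, f p) \<in> E"
          then have "(f p, f y) \<in> E" using False G.edge_sym by simp
          then have "y \<in> Y" using yD by (simp add: Y_def)
          moreover have "t \<in> nbhd F y" using y(2) T.edge_sym by simp
          ultimately show False using tN by (auto simp: N_def)
        qed
      qed
    qed
    then have P: "packs F E V D (f(p := r, t := f p))" using D0 by simp
    have "b \<notin> (f(p := r, t := f p)) ` D" using b r(7) D by auto
    moreover have "q \<noteq> t" using r(6) t by auto
    moreover have "\<forall>x\<in>D. x = p \<or> (f(p := r, t := f p)) x = f x \<or>
        (f(p := r, t := f p)) x = f p \<and> x \<notin> branching"
      using tB by simp
    ultimately show ?thesis using P r(1) rE tp
      by (intro exI[of _ "f(p := r, t := f p)"]) simp
  qed
qed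

section \<open>Bare paths and the reserve for few leaves\<close>

definition ball2 :: "'a \<Rightarrow> 'a set" where
  "ball2 v = {v} \<union> nbhd F v \<union> (\<Union>p\<in>nbhd F v. nbhd F p)"

lemma ball2_iff: "u \<in> ball2 v \<longleftrightarrow> u = v \<or> (v, u) \<in> F \<or> (\<exists>p. (v, p) \<in> F \<and> (p, u) \<in> F)"
  by (auto simp: ball2_def)

lemma ball2_sym: "u \<in> ball2 v \<Longrightarrow> v \<in> ball2 u"
  unfolding ball2_iff by (meson T.edge_sym)

text \<open>Middle vertices of bare paths. While such a vertex is unplaced, each of its neighbours
  has at most one placed neighbour, as \<open>relocate\<close> demands.\<close>

definition flexible :: "'a set" where
  "flexible = {v \<in> VT. card (nbhd F v) = 2 \<and> (\<forall>p\<in>nbhd F v. card (nbhd F p) \<le> 2)}"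

lemma card_ball2:
  assumes "v \<in> flexible" shows "card (ball2 v) \<le> 5"
proof -
  have v: "card (nbhd F v) = 2" "\<And>p. p \<in> nbhd F v \<Longrightarrow> card (nbhd F p) \<le> 2"
    using assms by (auto simp: flexible_def)
  let ?U = "\<Union>p\<in>nbhd F v. nbhd F p - {v}"
  have "card (nbhd F p - {v}) \<le> 1" if "p \<in> nbhd F v" for p
    using v(2)[OF that] that T.edge_sym[of v p] by simp
  then have "(\<Sum>p\<in>nbhd F v. card (nbhd F p - {v})) \<le> card (nbhd F v) * 1"
    using sum_bounded_above[of "nbhd F v" "\<lambda>p. card (nbhd F p - {v})" 1] by simp
  then have U: "card ?U \<le> 2"
    using card_UN_le[OF T.finite_nbhd, of "\<lambda>p. nbhd F p - {v}" v] v(1) by simp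
  have "ball2 v = {v} \<union> nbhd F v \<union> ?U" by (auto simp: ball2_def)
  then show ?thesis
    using card_Un_le[of "{v} \<union> nbhd F v" ?U] card_Un_le[of "{v}" "nbhd F v"] v(1) U by simp
qed

text \<open>A vertex that is not flexible is a leaf, a branching vertex or a neighbour of a
  branching vertex. With \<open>L = card leaves\<close>, these kinds number at most
  \<open>L\<close>, \<open>L\<close> and \<open>3 * L\<close>.\<close>

lemma card_flexible: "n \<le> card flexible + 5 * card leaves"
proof -
  let ?N = "\<Union>y\<in>branching. nbhd F y"
  have "VT \<subseteq> flexible \<union> leaves \<union> branching \<union> ?N"
  proof
    fix v assume v: "v \<in> VT"
    show "v \<in> flexible \<union> leaves \<union> branching \<union> ?N"
    proof (rule ccontr)
      assume *: "v \<notin> flexible \<union> leaves \<union> branching \<union> ?N"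
      then have "card (nbhd F v) = 2" using v degree_pos[OF v] by (auto simp: leaves_def branching_def)
      then obtain p where p: "(v, p) \<in> F" "\<not> card (nbhd F p) \<le> 2"
        using * v by (auto simp: flexible_def)
      then have "p \<in> branching" using T.edges_in by (auto simp: branching_def)
      moreover have "v \<in> nbhd F p" using p T.edge_sym by simp
      ultimately show False using * by blast
    qed
  qed
  moreover have "finite (flexible \<union> leaves \<union> branching \<union> ?N)"
    using T.finite_V finite_branching finite_leaves by (simp add: flexible_def)
  ultimately have "n \<le> card (flexible \<union> leaves \<union> branching \<union> ?N)"
    using card_mono card_VT by metis
  moreover have "card ?N \<le> 2 * card branching + card leaves"
    by (rule card_nbhds) (auto simp: branching_def)
  ultimately show ?thesis
    using card_Un_le[of "flexible \<union> leaves \<union> branching" ?N] card_Un_le[of "flexible \<union> leaves" branching]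
      card_Un_le[of flexible leaves] card_branching by linarith
qed

lemma card_ball2s:
  assumes "F' \<subseteq> flexible" shows "card (\<Union>f\<in>F'. ball2 f) \<le> 5 * card F'"
proof -
  have "finite F'" using assms T.finite_V by (auto simp: flexible_def intro: finite_subset)
  then have "card (\<Union>f\<in>F'. ball2 f) \<le> (\<Sum>f\<in>F'. card (ball2 f))" by (rule card_UN_le)
  also have "\<dots> \<le> card F' * 5"
    using sum_bounded_above[of F' "\<lambda>f. card (ball2 f)" 5] card_ball2 assms by auto
  finally show ?thesis by simp
qed

text \<open>Each chosen vertex rules out at most the five vertices of its ball, so a greedy choice
  succeeds.\<close>

lemma separated_flexible:
  assumes "5 * m \<le> card flexible"
  shows "\<exists>F'\<subseteq>flexible. card F' = m \<and> (\<forall>f\<in>F'. \<forall>g\<in>F'. f \<noteq> g \<longrightarrow> g \<notin> ball2 f)"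
  using assms
proof (induction m)
  case 0
  then show ?case by (intro exI[of _ "{}"]) simp
next
  case (Suc m)
  then obtain F' where F': "F' \<subseteq> flexible" "card F' = m" "\<And>f g. f \<in> F' \<Longrightarrow> g \<in> F' \<Longrightarrow> f \<noteq> g \<Longrightarrow> g \<notin> ball2 f"
    by auto
  have fF: "finite F'" using F' T.finite_V by (auto simp: flexible_def intro: finite_subset)
  have "card (\<Union>f\<in>F'. ball2 f) < card flexible" using card_ball2s[OF F'(1)] F'(2) Suc.prems by simp
  moreover have "finite (\<Union>f\<in>F'. ball2 f)" using fF by (simp add: ball2_def)
  ultimately have "\<not> flexible \<subseteq> (\<Union>f\<in>F'. ball2 f)" by (meson card_mono not_le)
  then obtain g where g: "g \<in> flexible" "\<And>f. f \<in> F' \<Longrightarrow> g \<notin> ball2 f" by blast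
  have "g \<notin> F'" using g(2)[of g] by (auto simp: ball2_def)
  then have "card (insert g F') = Suc m" using fF F'(2) by simp
  moreover have "b \<notin> ball2 a" if "a \<in> insert g F'" "b \<in> insert g F'" "a \<noteq> b" for a b
    using that F'(3)[of a b] g(2)[of a] g(2)[of b] ball2_sym[of b a] by auto
  ultimately show ?case using g(1) F'(1) by (intro exI[of _ "insert g F'"]) auto
qed

text \<open>The size \<open>2 * d + 1\<close> of \<open>F'\<close> is chosen for exchanges: an
  unplaced vertex of \<open>J\<close> has at most two neighbours, whose low images block at most
  \<open>2 * d\<close> places, so the image of some member of \<open>F'\<close> is free for it. The
  rest of \<open>J\<close> is an independent half of the non-branching vertices away from
  \<open>F'\<close>.\<close>

lemma few_leaves_reserve:
  assumes few: "10 * card leaves < n"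
  shows "\<exists>J F'. F' \<subseteq> J \<and> J \<subseteq> VT \<and> indep_in F J \<and> (\<forall>x\<in>J. card (nbhd F x) \<le> 2) \<and>
    card F' = 2 * d + 1 \<and> F' \<subseteq> flexible \<and> (\<forall>f\<in>F'. \<forall>p\<in>nbhd F f. \<forall>w\<in>nbhd F p - {f}. w \<notin> J) \<and>
    card (VT - J) + d \<le> card low"
proof -
  obtain j where j: "k = j + 2" "d = 4 * j" "20 * (j * j) + 80 * j + 80 \<le> n" "j \<le> j * j"
    using numbers .
  have "10 * d + 5 \<le> card flexible" using card_flexible few j by linarith
  then have "5 * (2 * d + 1) \<le> card flexible" by simp
  then obtain F' where F': "F' \<subseteq> flexible" "card F' = 2 * d + 1"
    "\<And>f g. f \<in> F' \<Longrightarrow> g \<in> F' \<Longrightarrow> f \<noteq> g \<Longrightarrow> g \<notin> ball2 f"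
    using separated_flexible[of "2 * d + 1"] by auto
  have fF: "finite F'" using F' T.finite_V by (auto simp: flexible_def intro: finite_subset)
  \<comment> \<open>Removing the balls keeps \<open>J2\<close> at distance at least 3 from
    \<open>F'\<close>. This gives independence across the two pieces and keeps the vertices at
    distance 2 from \<open>F'\<close> out of \<open>J\<close>.\<close>
  define B where "B = (\<Union>f\<in>F'. ball2 f)"
  define A where "A = VT - branching - B"
  have fB: "finite B" using fF by (simp add: B_def ball2_def)
  have "n \<le> card A + card branching + card B"
  proof -
    have "VT \<subseteq> A \<union> branching \<union> B" by (auto simp: A_def)
    then have "n \<le> card (A \<union> branching \<union> B)"
      using card_mono[of "A \<union> branching \<union> B" VT] T.finite_V fB finite_branching card_VT by (simp add: A_def)
    then show ?thesis using card_Un_le[of "A \<union> branching" B] card_Un_le[of A branching] by linarith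
  qed
  then have cA: "n \<le> card A + card leaves + (10 * d + 5)"
    using card_branching card_ball2s[OF F'(1)] F'(2) by (simp add: B_def)
  obtain J2 where J2: "J2 \<subseteq> A" "indep_in F J2" "card A \<le> 2 * card J2"
    using T.half_independent[of A] by (auto simp: A_def)
  define J where "J = F' \<union> J2"
  have notB: "x \<notin> ball2 f" if "x \<in> J" "f \<in> F'" "x \<noteq> f" for x f
    using that F'(3) J2(1) by (auto simp: J_def A_def B_def)
  have sub: "F' \<subseteq> J" "J \<subseteq> VT" using F'(1) J2(1) by (auto simp: J_def A_def flexible_def)
  have nF: "(f, x) \<notin> F" if "x \<in> J" "f \<in> F'" for x f
    using notB[of x f] that T.edge_irrefl[of f] by (auto simp: ball2_def)
  have "indep_in F J"
    unfolding indep_in_def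
  proof (intro ballI)
    fix u v assume uv: "u \<in> J" "v \<in> J"
    consider "u \<in> F'" | "v \<in> F'" | "u \<in> J2" "v \<in> J2" using uv by (auto simp: J_def)
    then show "(u, v) \<notin> F"
    proof cases
      case 2
      then show ?thesis using nF[of u v] uv T.edge_sym[of u v] by auto
    qed (use nF uv J2(2) in \<open>auto simp: indep_in_def\<close>)
  qed
  moreover have "\<forall>x\<in>J. card (nbhd F x) \<le> 2"
    using F'(1) J2(1) sub by (auto simp: J_def flexible_def A_def branching_def)
  moreover have "\<forall>f\<in>F'. \<forall>p\<in>nbhd F f. \<forall>w\<in>nbhd F p - {f}. w \<notin> J"
  proof (intro ballI notI)
    fix f p w assume "f \<in> F'" "p \<in> nbhd F f" "w \<in> nbhd F p - {f}" "w \<in> J"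
    then show False using notB[of w f] by (auto simp: ball2_def)
  qed
  moreover have "card (VT - J) + d \<le> card low"
  proof -
    have "F' \<inter> J2 = {}" using J2(1) by (auto simp: A_def B_def ball2_def)
    moreover have "finite J2" using J2(1) T.finite_V by (auto simp: A_def intro: finite_subset)
    ultimately have "card J = (2 * d + 1) + card J2" using fF F'(2) by (simp add: J_def card_Un_disjoint)
    moreover have "card (VT - J) = n - card J"
      using card_Diff_subset[of J VT] sub(2) T.finite_V card_VT finite_subset by metis
    moreover have "card J \<le> n" using card_mono[OF T.finite_V sub(2)] card_VT by simp
    ultimately show ?thesis using cA J2(3) card_low j few by linarith
  qed
  ultimately show ?thesis
    using sub F'(1,2) by (intro exI[of _ J] exI[of _ F'] conjI) assumption+
qed

end

lemma (in packing_setting) few_leaves_packing: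
  assumes few: "10 * card leaves < n"
  shows "\<exists>f. packs F E V VT f"
proof -
  obtain j where j: "k = j + 2" "d = 4 * j" "20 * (j * j) + 80 * j + 80 \<le> n" "j \<le> j * j"
    using numbers .
  obtain J F' where FJ: "F' \<subseteq> J" and JV: "J \<subseteq> VT" and indep: "indep_in F J"
    and J2': "\<forall>x\<in>J. card (nbhd F x) \<le> 2" and cF': "card F' = 2 * d + 1"
    and flex: "F' \<subseteq> flexible" and far': "\<forall>f\<in>F'. \<forall>p\<in>nbhd F f. \<forall>w\<in>nbhd F p - {f}. w \<notin> J"
    and room: "card (VT - J) + d \<le> card low"
    using few_leaves_reserve[OF few] by (elim exE conjE) (rule that)
  have J2: "card (nbhd F x) \<le> 2" if "x \<in> J" for x using J2' that by blast
  have far: "w \<notin> J" if "f \<in> F'" "p \<in> nbhd F f" "w \<in> nbhd F p - {f}" for f p w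
    using far' that by blast
  define K where "K = VT - J"
  have KV: "K \<subseteq> VT" by (auto simp: K_def)
  have nbJ: "nbhd F x \<subseteq> K" if "x \<in> J" for x
    using that indep T.edges_in by (auto simp: K_def indep_in_def)
  have brK: "branching \<subseteq> K" using J2 by (fastforce simp: K_def branching_def)
  \<comment> \<open>States are compared by the number of placed vertices. The images of
    \<open>K\<close> may change as long as they stay in \<open>low\<close>.\<close>
  define st where "st D f \<longleftrightarrow> K \<subseteq> D \<and> D \<subseteq> VT \<and> packs F E V D f \<and> f ` K \<subseteq> low" for D f
  have "\<exists>f. packs F E V ({} \<union> K) f \<and> (\<forall>p\<in>{}. f p = undefined p) \<and> f ` K \<subseteq> low"
    using room KV low_subset
    by (intro greedy_packing[OF T.forest_graph_axioms G.simple_graph_axioms])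
      (auto simp: packs_def low_def K_def)
  then obtain f0 where "st K f0" using KV by (auto simp: st_def)
  then have "st (fst (K, f0)) (snd (K, f0))" by simp
  moreover have "\<forall>y. st (fst y) (snd y) \<longrightarrow> card (fst y) < Suc n"
    using card_mono[OF T.finite_V] card_VT by (auto simp: st_def less_Suc_eq_le)
  ultimately obtain Df where "st (fst Df) (snd Df)" and
    "\<forall>y. st (fst y) (snd y) \<longrightarrow> card (fst y) \<le> card (fst Df)"
    using ex_has_greatest_nat[of "\<lambda>y. st (fst y) (snd y)" "(K, f0)" "\<lambda>y. card (fst y)" "Suc n"]
    by blast
  then obtain D0 g0 where st0: "st D0 g0" and max: "\<And>D f. st D f \<Longrightarrow> card D \<le> card D0"
    by (metis fst_conv snd_conv)
  have "D0 = VT"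
  proof (rule ccontr)
    assume ne: "D0 \<noteq> VT"
    \<comment> \<open>The missing vertex may be assumed to lie in \<open>F'\<close>: otherwise it
      takes over the image of a member of \<open>F'\<close> that its neighbours do not
      block.\<close>
    have "\<exists>D f x. st D f \<and> card D = card D0 \<and> x \<in> F' - D"
    proof (cases "F' \<subseteq> D0")
      case False
      then show ?thesis using st0 by blast
    next
      case True
      obtain x0 where x0: "x0 \<in> VT" "x0 \<notin> D0" using ne st0 by (auto simp: st_def)
      then have x0J: "x0 \<in> J" using st0 by (auto simp: st_def K_def)
      have inj: "inj_on g0 D0" using st0 by (simp add: st_def packs_def)
      have "g0 ` nbhd F x0 \<subseteq> low"
        using st0 image_mono[OF nbJ[OF x0J], of g0] unfolding st_def by blast
      then have "card (\<Union>y\<in>nbhd F x0. nbhd E (g0 y)) \<le> card (nbhd F x0) * d"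
        by (intro card_blocked) simp_all
      also have "\<dots> \<le> 2 * d" using J2[OF x0J] by (rule mult_right_mono) simp
      finally have "card (\<Union>y\<in>nbhd F x0. nbhd E (g0 y)) < card F'" using cF' by simp
      also have "card F' = card (g0 ` F')"
        using inj_on_subset[OF inj True] by (simp add: card_image)
      finally have "\<not> g0 ` F' \<subseteq> (\<Union>y\<in>nbhd F x0. nbhd E (g0 y))"
        by (meson T.finite_nbhd G.finite_nbhd card_mono finite_UN_I not_le)
      then obtain x where "x \<in> F'" "g0 x \<notin> (\<Union>y\<in>nbhd F x0. nbhd E (g0 y))"
        by (meson image_subsetI)
      then have x: "x \<in> F'" "\<And>y. (x0, y) \<in> F \<Longrightarrow> (g0 y, g0 x) \<notin> E" by simp_all
      have xD: "x \<in> D0" using x True by auto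
      have "packs F E V (insert x0 (D0 - {x})) (g0(x0 := g0 x))"
        using st0 x0 xD x(2) by (intro exchange) (auto simp: st_def)
      moreover have "K \<subseteq> insert x0 (D0 - {x})" using st0 x FJ by (auto simp: st_def K_def)
      moreover have "insert x0 (D0 - {x}) \<subseteq> VT" using st0 x0 by (auto simp: st_def)
      moreover have "(g0(x0 := g0 x)) ` K \<subseteq> low" using st0 x0J by (auto simp: st_def K_def)
      ultimately have "st (insert x0 (D0 - {x})) (g0(x0 := g0 x))" by (simp add: st_def)
      moreover have "card (insert x0 (D0 - {x})) = card D0"
      proof -
        have "finite D0" using st0 T.finite_V by (auto simp: st_def intro: finite_subset)
        then show ?thesis using x0 xD card_Suc_Diff1[of D0 x] by simp
      qed
      moreover have "x \<in> F' - insert x0 (D0 - {x})" using x xD x0 by auto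
      ultimately show ?thesis by blast
    qed
    then obtain D f x where st: "st D f" and cD: "card D = card D0" and x: "x \<in> F'" "x \<notin> D" by blast
    have xJ: "x \<in> J" and xV: "x \<in> VT" using x FJ JV by auto
    have D: "K \<subseteq> D" "D \<subseteq> VT" "packs F E V D f" "f ` K \<subseteq> low" using st by (auto simp: st_def)
    have fD: "finite D" using D(2) T.finite_V finite_subset by blast
    have "card (nbhd F x) = 2" using flex x by (auto simp: flexible_def)
    then obtain p q where pq: "nbhd F x = {p, q}" "p \<noteq> q" by (meson card_2_iff)
    have pqK: "p \<in> K" "q \<in> K" using nbJ[OF xJ] pq by auto
    have deg: "card (nbhd F y) \<le> 2" if "y \<in> {p, q}" for y
      using flex x pq that by (auto simp: flexible_def)
    \<comment> \<open>Neither of the two relocations moves a branching vertex, so the same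
      \<open>S\<close> serves both.\<close>
    define S where "S = low - f ` branching"
    have around: "card (nbhd F y \<inter> D) \<le> 1 \<and> nbhd F y \<inter> D \<subseteq> K \<and> y \<notin> branching" if "y \<in> {p, q}" for y
    proof -
      have yx: "x \<in> nbhd F y" using that pq T.edge_sym[of x y] in_nbhd[of y F x] by auto
      have "nbhd F y \<inter> D \<subseteq> nbhd F y - {x}" using x by auto
      then have "card (nbhd F y \<inter> D) \<le> card (nbhd F y - {x})" by (intro card_mono) auto
      also have "\<dots> \<le> 1" using yx deg[OF that] by simp
      finally have "card (nbhd F y \<inter> D) \<le> 1" .
      moreover have "nbhd F y \<inter> D \<subseteq> K"
        using far[OF x(1), of y] that pq D(2) x(2) by (fastforce simp: K_def)
      moreover have "y \<notin> branching" using deg[OF that] by (auto simp: branching_def)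
      ultimately show ?thesis by blast
    qed
    \<comment> \<open>If \<open>b\<close> missed more of \<open>S\<close>, first \<open>p\<close>
      and then \<open>q\<close> could be moved to non-neighbours of \<open>b\<close>; then
      \<open>x\<close> would fit on \<open>b\<close>, against maximality.\<close>
    have miss: "card (S - nbhd E b) \<le> 3 * d + card leaves + 4" if b: "b \<in> V - f ` D" for b
    proof (rule ccontr)
      assume "\<not> ?thesis"
      then have many: "3 * d + card leaves + 4 < card (S - nbhd E b)" by simp
      have SV: "S \<subseteq> V" using low_subset by (auto simp: S_def)
      have "\<exists>f'. packs F E V D f' \<and> b \<notin> f' ` D \<and> (f' p, b) \<notin> E \<and> f' p \<in> S \<and>
          f' q = (if q = p then f' p else f q) \<and>
          (\<forall>x\<in>D. x = p \<or> f' x = f x \<or> f' x = f p \<and> x \<notin> branching)"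
      proof (rule relocate[OF D(3,2)])
        show "p \<in> D" "b \<in> V" "b \<notin> f ` D" "f p \<in> low" using pqK D b by auto
        show "card (nbhd F p \<inter> D) \<le> 1" using around by auto
        have "nbhd F p \<inter> D \<subseteq> K" using around[of p] by simp
        then show "f ` (nbhd F p \<inter> D) \<subseteq> low" using D(4) by blast
        show "S \<inter> f ` branching = {}" by (auto simp: S_def)
      qed (use SV many in auto)
      then obtain f1 where f1: "packs F E V D f1" "b \<notin> f1 ` D" "(f1 p, b) \<notin> E" "f1 p \<in> S"
        "\<And>x. x \<in> D \<Longrightarrow> x = p \<or> f1 x = f x \<or> f1 x = f p \<and> x \<notin> branching" by blast
      have low1: "f1 y \<in> low" if "y \<in> K" for y
        using f1(4) f1(5)[of y] that D(1,4) pqK(1) by (auto simp: S_def)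
      have br1: "f1 y = f y" if "y \<in> branching" for y
        using f1(5)[of y] that brK D(1) around[of p] by auto
      have "\<exists>f'. packs F E V D f' \<and> b \<notin> f' ` D \<and> (f' q, b) \<notin> E \<and> f' q \<in> S \<and>
          f' p = (if p = q then f' q else f1 p) \<and>
          (\<forall>x\<in>D. x = q \<or> f' x = f1 x \<or> f' x = f1 q \<and> x \<notin> branching)"
      proof (rule relocate[OF f1(1) D(2)])
        show "q \<in> D" "b \<in> V" "b \<notin> f1 ` D" "f1 q \<in> low" using pqK D b f1 low1 by auto
        show "card (nbhd F q \<inter> D) \<le> 1" using around by auto
        have "nbhd F q \<inter> D \<subseteq> K" using around[of q] by simp
        then show "f1 ` (nbhd F q \<inter> D) \<subseteq> low" using low1 by blast
        show "S \<inter> f1 ` branching = {}" using br1 by (auto simp: S_def)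
      qed (use SV many in auto)
      then obtain f2 where f2: "packs F E V D f2" "b \<notin> f2 ` D" "(f2 q, b) \<notin> E" "f2 q \<in> S" "f2 p = f1 p"
        "\<And>x. x \<in> D \<Longrightarrow> x = q \<or> f2 x = f1 x \<or> f2 x = f1 q \<and> x \<notin> branching" using pq(2) by auto
      have low2: "f2 y \<in> low" if "y \<in> K" for y
      proof -
        have "f2 q \<in> low" using f2(4) by (simp add: S_def)
        moreover have "f1 q \<in> low" "f1 y \<in> low" using low1 pqK(2) that by blast+
        moreover have "y \<in> D" using that D(1) by blast
        ultimately show ?thesis using f2(6)[of y] by metis
      qed
      have "packs F E V (insert x D) (f2(x := b))"
      proof (rule extend[OF f2(1) x(2)])
        show "b \<in> V" "b \<notin> f2 ` D" using b f2 by auto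
        show "(f2 y, b) \<notin> E" if "y \<in> D" "(x, y) \<in> F" for y
          using that pq(1) f2(3,5) f1(3) in_nbhd[of y F x] by auto
      qed
      moreover have "(f2(x := b)) ` K \<subseteq> low" using low2 xJ by (auto simp: K_def)
      ultimately have "st (insert x D) (f2(x := b))" using D xV by (auto simp: st_def)
      from max[OF this] show False using cD x fD by simp
    qed
    have "D \<noteq> VT" using x xV by auto
    then have U: "k div 2 \<le> card (V - f ` D)" using card_unused[OF D(3,2)] by simp
    have fS: "finite S" using finite_low by (simp add: S_def)
    have "card low - card (f ` branching) \<le> card S"
      unfolding S_def by (rule diff_card_le_card_Diff) (simp add: finite_branching)
    moreover have "card (f ` branching) \<le> card leaves"
      using card_image_le[OF finite_branching, of f] card_branching by linarith
    \<comment> \<open>From the \<open>3 * n / 4\<close> vertices of \<open>low\<close>, three times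
      \<open>card leaves\<close> takes less than \<open>3 * n / 10\<close>; what is left covers the
      terms linear in \<open>k\<close>.\<close>
    ultimately have "2 * (3 * d + card leaves + 4) + k + 1 \<le> card S"
      using card_low few j by (simp add: algebra_simps)
    from nearly_complete_gpath[OF G.simple_graph_axioms _ fS U k miss this]
    obtain xs where xs: "gpath E xs" "length xs = k" "set xs \<subseteq> (V - f ` D) \<union> S"
      using G.finite_V by auto
    have "set xs \<subseteq> V" using xs(3) low_subset by (auto simp: S_def)
    then show False using no_path[OF xs(1)] xs(2) by simp
  qed
  then show ?thesis using st0 by (auto simp: st_def)
qed

section \<open>Trees with many leaves\<close>

context packing_setting
begin

text \<open>If some vertex has degree below \<open>k div 2\<close>, take it with \<open>Q\<close>
  empty. Otherwise there is a closed set \<open>X\<close> of at most \<open>k - 1\<close> vertices;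
  \<open>v0\<close> is any of them and \<open>Q\<close> is the surplus of its neighbours over
  \<open>k div 2 - 1\<close>. In both cases \<open>v0\<close> and \<open>Q\<close> block nothing
  outside \<open>X\<close>.\<close>

lemma special_vertex:
  "\<exists>v0 Q X. v0 \<in> V \<and> Q \<subseteq> nbhd E v0 \<and> card (nbhd E v0 - Q) < k div 2 \<and> 2 * card Q \<le> k \<and>
    insert v0 (nbhd E v0) \<subseteq> X \<and> X \<subseteq> V \<and> card X \<le> k - 1 \<and> (\<forall>u\<in>Q. nbhd E u \<subseteq> X)"
proof -
  have h: "1 \<le> k div 2" using k by simp
  have "V \<noteq> {}"
  proof
    assume "V = {}"
    then have "n + k div 2 = 1" using card_V by simp
    moreover obtain j where "20 * (j * j) + 80 * j + 80 \<le> n" using numbers by metis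
    ultimately show False by linarith
  qed
  from G.low_degree_or_small_component[OF no_path this k] show ?thesis
  proof
    assume "\<exists>v\<in>V. card (nbhd E v) \<le> k div 2 - 1"
    then obtain v where v: "v \<in> V" "card (nbhd E v) \<le> k div 2 - 1" by blast
    have "card (insert v (nbhd E v)) \<le> k div 2"
      using v(2) h card_insert_le_m1[of "k div 2" "nbhd E v" v] by simp
    then have "card (insert v (nbhd E v)) \<le> k - 1" using k by linarith
    moreover have "insert v (nbhd E v) \<subseteq> V" using v G.nbhd_subset by blast
    moreover have "card (nbhd E v) < k div 2" using v h by linarith
    ultimately show ?thesis using v(1)
      by (intro exI[of _ v] exI[of _ "{}"] exI[of _ "insert v (nbhd E v)"]) simp
  next
    assume "\<exists>X. X \<noteq> {} \<and> X \<subseteq> V \<and> (\<forall>v\<in>X. nbhd E v \<subseteq> X) \<and> card X \<le> k - 1"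
    then obtain X where X: "X \<noteq> {}" "X \<subseteq> V" "\<forall>v\<in>X. nbhd E v \<subseteq> X" "card X \<le> k - 1" by blast
    then obtain v where v: "v \<in> X" by blast
    have fX: "finite X" using X(2) G.finite_V finite_subset by blast
    have sub: "nbhd E v \<subseteq> X - {v}" using X(3) v G.edge_irrefl[of v] by auto
    have "card (nbhd E v) \<le> card (X - {v})" using sub fX by (intro card_mono) auto
    also have "\<dots> \<le> k - 2" using v fX X(4) by simp
    finally have deg: "card (nbhd E v) \<le> k - 2" .
    obtain Q where Q: "Q \<subseteq> nbhd E v" "card Q = card (nbhd E v) - (k div 2 - 1)"
      using obtain_subset_with_card_n[of "card (nbhd E v) - (k div 2 - 1)" "nbhd E v"] by auto
    have "card (nbhd E v - Q) = card (nbhd E v) - card Q"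
      using Q(1) by (intro card_Diff_subset) (auto intro: finite_subset[OF Q(1)])
    then have "card (nbhd E v - Q) < k div 2" using Q(2) h by linarith
    moreover have "2 * card Q \<le> k" using Q(2) deg by linarith
    moreover have "\<forall>u\<in>Q. nbhd E u \<subseteq> X" using Q(1) sub X(3) by blast
    moreover have "insert v (nbhd E v) \<subseteq> X" using v sub by blast
    moreover have "v \<in> V" using v X(2) by blast
    ultimately show ?thesis using Q(1) X(2,4)
      by (intro exI[of _ v] exI[of _ Q] exI[of _ X]) simp
  qed
qed

text \<open>Two adjacent leaves would form a whole component, but the tree is connected and
  larger.\<close>

lemma leaves_not_adjacent:
  assumes "u \<in> leaves" "v \<in> leaves" shows "(u, v) \<notin> F"
proof
  assume uv: "(u, v) \<in> F"
  obtain j where j: "20 * (j * j) + 80 * j + 80 \<le> n" using numbers by metis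
  have "{u, v} \<noteq> VT"
  proof
    assume "{u, v} = VT"
    moreover have "card {u, v} \<le> 2" by (simp add: card_insert_if)
    ultimately show False using card_VT j by simp
  qed
  then obtain x y where xy: "x \<in> {u, v}" "y \<notin> {u, v}" "(x, y) \<in> F"
    using edge_leaving[of "{u, v}"] assms by (auto simp: leaves_def)
  have "nbhd F x = {y}" if "x \<in> leaves" "(x, y) \<in> F" for x y
  proof -
    have "card (nbhd F x) = 1" using that by (simp add: leaves_def)
    then obtain z where "nbhd F x = {z}" by (rule card_1_singletonE)
    then show ?thesis using that(2) in_nbhd[of y F x] by simp
  qed
  then have "nbhd F u = {v}" "nbhd F v = {u}" using assms uv T.edge_sym[OF uv] by blast+
  then show False using xy in_nbhd[of y F x] by auto
qed

text \<open>The reserve takes all leaves outside \<open>P\<close> and at least half of the other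
  non-branching vertices that are not next to a leaf. Up to terms in \<open>k\<close>, it has at
  least \<open>card leaves\<close> and at least \<open>(n - card leaves) / 2\<close> members, hence
  at least \<open>n / 3\<close>, and the rest fits into \<open>low\<close>. The term
  \<open>k - 1\<close> is room for omitting \<open>X\<close>.\<close>

lemma reserve_with_leaves:
  assumes P: "P \<subseteq> VT" "card P \<le> k div 2 + 1"
  shows "\<exists>J. leaves - P \<subseteq> J \<and> J \<subseteq> VT - P \<and> indep_in F J \<and> (\<forall>x\<in>J. card (nbhd F x) \<le> 2) \<and>
    card (VT - J) + d + (k - 1) \<le> card low"
proof -
  obtain j where j: "k = j + 2" "d = 4 * j" "20 * (j * j) + 80 * j + 80 \<le> n" "j \<le> j * j"
    using numbers .
  have fP: "finite P" using P T.finite_V finite_subset by blast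
  define N where "N = (\<Union>y\<in>leaves. nbhd F y)"
  define Z where "Z = VT - branching - leaves - N - P"
  have "card N \<le> (\<Sum>y\<in>leaves. card (nbhd F y))"
    unfolding N_def by (rule card_UN_le[OF finite_leaves])
  also have "\<dots> = card leaves" by (simp add: leaves_def)
  finally have cN: "card N \<le> card leaves" .
  have fN: "finite N" using finite_leaves by (simp add: N_def)
  have "VT \<subseteq> Z \<union> branching \<union> leaves \<union> N \<union> P" by (auto simp: Z_def)
  moreover have "finite (Z \<union> branching \<union> leaves \<union> N \<union> P)"
    using T.finite_V finite_branching finite_leaves fN fP by (simp add: Z_def)
  ultimately have "n \<le> card (Z \<union> branching \<union> leaves \<union> N \<union> P)" using card_mono card_VT by metis
  then have cZ: "n \<le> card Z + 3 * card leaves + card P"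
    using card_Un_le[of "Z \<union> branching \<union> leaves \<union> N" P] card_Un_le[of "Z \<union> branching \<union> leaves" N]
      card_Un_le[of "Z \<union> branching" leaves] card_Un_le[of Z branching] card_branching cN by linarith
  obtain J2 where J2: "J2 \<subseteq> Z" "indep_in F J2" "card Z \<le> 2 * card J2"
    using T.half_independent[of Z] by (auto simp: Z_def)
  define J where "J = (leaves - P) \<union> J2"
  have sub: "J \<subseteq> VT - P" using J2(1) by (auto simp: J_def Z_def leaves_def)
  have cross: "(u, v) \<notin> F \<and> (v, u) \<notin> F" if "u \<in> leaves" "v \<in> J2" for u v
  proof -
    have "v \<notin> N" using that J2(1) by (auto simp: Z_def)
    then have "(u, v) \<notin> F" using that(1) by (auto simp: N_def)
    then show ?thesis using T.edge_sym[of v u] by blast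
  qed
  have "indep_in F J"
    unfolding indep_in_def
  proof (intro ballI)
    fix u v assume "u \<in> J" "v \<in> J"
    then consider "u \<in> leaves" "v \<in> leaves" | "u \<in> leaves" "v \<in> J2" | "u \<in> J2" "v \<in> leaves"
      | "u \<in> J2" "v \<in> J2"
      by (auto simp: J_def)
    then show "(u, v) \<notin> F"
      by cases (use leaves_not_adjacent cross J2(2) in \<open>auto simp: indep_in_def\<close>)
  qed
  moreover have "\<forall>x\<in>J. card (nbhd F x) \<le> 2"
    using J2(1) by (auto simp: J_def Z_def leaves_def branching_def)
  moreover have "card (VT - J) + d + (k - 1) \<le> card low"
  proof -
    have fin: "finite J2" "finite J" using sub T.finite_V J2(1) by (auto simp: J_def Z_def intro: finite_subset)
    have "(leaves - P) \<inter> J2 = {}" using J2(1) by (auto simp: Z_def)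
    then have "card J = card (leaves - P) + card J2"
      using fin finite_leaves by (simp add: J_def card_Un_disjoint)
    moreover have "card leaves - card P \<le> card (leaves - P)" by (rule diff_card_le_card_Diff[OF fP])
    moreover have "card (VT - J) = n - card J"
      using card_Diff_subset[OF fin(2), of VT] sub card_VT by auto
    moreover have "card J \<le> n" using card_mono[OF T.finite_V, of J] sub card_VT by auto
    moreover have "2 * (k div 2) \<le> k" by simp
    ultimately show ?thesis using cZ J2(3) card_low P(2) j by linarith
  qed
  ultimately show ?thesis using sub
    by (intro exI[of _ J] conjI) (assumption | simp add: J_def)+
qed

end

lemma (in packing_setting) many_leaves_packing:
  assumes many: "n \<le> 10 * card leaves"
  shows "\<exists>f. packs F E V VT f"
proof -
  obtain j where j: "k = j + 2" "d = 4 * j" "20 * (j * j) + 80 * j + 80 \<le> n" "j \<le> j * j"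
    using numbers .
  obtain v0 Q X where v0: "v0 \<in> V" "Q \<subseteq> nbhd E v0" "card (nbhd E v0 - Q) < k div 2" "2 * card Q \<le> k"
    and X: "insert v0 (nbhd E v0) \<subseteq> X" "X \<subseteq> V" "card X \<le> k - 1" and QX: "\<forall>u\<in>Q. nbhd E u \<subseteq> X"
    using special_vertex by (elim exE conjE) (rule that)
  have fX: "finite X" using X(2) G.finite_V finite_subset by blast
  have fQ: "finite Q" using v0(2) by (rule finite_subset) simp
  have insideX: "u \<in> low \<and> u \<in> X \<and> nbhd E u \<subseteq> X" if "u \<in> insert v0 Q" for u
  proof -
    have uX: "u \<in> X" using that X(1) v0(2) by blast
    have nX: "nbhd E u \<subseteq> X" using that X(1) QX by blast
    then have "nbhd E u \<subseteq> X - {u}" using G.edge_irrefl[of u] by auto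
    then have "card (nbhd E u) \<le> card (X - {u})" using fX by (intro card_mono) auto
    also have "\<dots> \<le> k - 2" using uX fX X(3) by simp
    finally have "card (nbhd E u) \<le> d" using j by simp
    then show ?thesis using uX nX X(2) by (auto simp: low_def)
  qed
  \<comment> \<open>\<open>c\<close> will carry the most leaves. Keeping it out of the set
    \<open>A\<close> below then bounds the leaves at every vertex.\<close>
  define lam where "lam v = card (nbhd F v \<inter> leaves)" for v
  have VTne: "VT \<noteq> {}" using card_VT j by auto
  have "Max (lam ` VT) \<in> lam ` VT" using VTne T.finite_V by (intro Max_in) auto
  then obtain c where c: "c \<in> VT" "lam c = Max (lam ` VT)" by auto
  have lam_c: "lam v \<le> lam c" if "v \<in> VT" for v using that c(2) T.finite_V by simp
  define R where "R = VT - insert c (nbhd F c)"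
  \<comment> \<open>Here the bound on the maximum degree enters: \<open>c\<close> has at least
    \<open>k\<close> non-neighbours, and an independent half of them suffices to occupy
    \<open>Q\<close>.\<close>
  have "card R \<ge> k"
  proof -
    have "card (insert c (nbhd F c)) \<le> Suc (card (nbhd F c))" by (simp add: card_insert_if)
    moreover have "card VT - card (insert c (nbhd F c)) \<le> card R"
      unfolding R_def by (rule diff_card_le_card_Diff) simp
    ultimately show ?thesis using degree_less[OF c(1)] card_VT by linarith
  qed
  moreover obtain I1 where I1: "I1 \<subseteq> R" "indep_in F I1" "card R \<le> 2 * card I1"
    using T.half_independent[of R] by (auto simp: R_def)
  ultimately have "card Q \<le> card I1" using v0(4) by linarith
  then obtain I where I: "I \<subseteq> I1" "card I = card Q" by (meson obtain_subset_with_card_n)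
  have IR: "I \<subseteq> R" using I(1) I1(1) by blast
  have fI: "finite I" using IR T.finite_V by (auto simp: R_def intro: finite_subset)
  obtain g where g: "bij_betw g I Q" using finite_same_card_bij[OF fI fQ I(2)] by blast
  define P where "P = insert c I"
  define g0 where "g0 = g(c := v0)"
  have cI: "c \<notin> I" using IR by (auto simp: R_def)
  have g0I: "g0 x = g x" if "x \<in> I" for x using that cI by (auto simp: g0_def)
  have g0im: "g0 ` I = Q" using g g0I by (simp add: bij_betw_def)
  have v0Q: "v0 \<notin> Q" using v0(2) G.edge_irrefl[of v0] by auto
  \<comment> \<open>\<open>P\<close> spans no tree edge: \<open>I\<close> is independent and avoids
    the neighbours of \<open>c\<close>. So only injectivity matters.\<close>
  have "packs F E V P g0"
    unfolding packs_def
  proof (intro conjI ballI impI)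
    have "inj_on g0 I" using g g0I by (simp add: bij_betw_def cong: inj_on_cong)
    then show "inj_on g0 P" using g0im v0Q cI by (auto simp: P_def g0_def)
    show "g0 ` P \<subseteq> V" using g0im v0(1,2) G.nbhd_subset by (auto simp: P_def g0_def)
    fix u v assume uv: "u \<in> P" "v \<in> P" "(u, v) \<in> F"
    have "(c, w) \<notin> F" "(w, c) \<notin> F" if "w \<in> I" for w
      using IR that T.edge_sym[of w c] by (auto simp: R_def)
    moreover have "(a, b) \<notin> F" if "a \<in> I" "b \<in> I" for a b
      using that I(1) I1(2) by (auto simp: indep_in_def)
    ultimately have False using uv T.edge_irrefl by (auto simp: P_def)
    then show "(g0 u, g0 v) \<notin> E" ..
  qed
  note P_packs = this
  have fP: "finite P" using fI by (simp add: P_def)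
  have PV: "P \<subseteq> VT" using c IR by (auto simp: P_def R_def)
  have g0P: "g0 ` P = insert v0 Q" by (simp only: P_def image_insert g0im) (simp add: g0_def)
  have cP: "card P \<le> k div 2 + 1" using I(2) v0(4) fI cI by (simp add: P_def)
  obtain J where J: "leaves - P \<subseteq> J" "J \<subseteq> VT - P" "indep_in F J" "\<forall>x\<in>J. card (nbhd F x) \<le> 2"
    "card (VT - J) + d + (k - 1) \<le> card low"
    using reserve_with_leaves[OF PV cP] by (elim exE conjE) (rule that)
  define K where "K = VT - J"
  have PK: "P \<subseteq> K" using PV J(2) by (auto simp: K_def)
  \<comment> \<open>Nothing outside \<open>X\<close> is joined to \<open>v0\<close> or
    \<open>Q\<close>, so the placement of \<open>P\<close> does not hinder the rest of
    \<open>K\<close>.\<close>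
  have "\<exists>f. packs F E V (P \<union> (K - P)) f \<and> (\<forall>p\<in>P. f p = g0 p) \<and> f ` (K - P) \<subseteq> low - X"
  proof (rule greedy_packing[OF T.forest_graph_axioms G.simple_graph_axioms P_packs fP])
    show "K - P \<subseteq> VT" "(K - P) \<inter> P = {}" by (auto simp: K_def)
    show "low - X \<subseteq> V" using low_subset by blast
    show "card (nbhd E v) \<le> d" if "v \<in> low - X" for v using that by (simp add: low_def)
    show "(low - X) \<inter> g0 ` P = {}" using insideX g0P by auto
    show "(g0 p, v) \<notin> E" if "p \<in> P" "v \<in> low - X" for p v
    proof -
      have "g0 p \<in> insert v0 Q" using g0P that(1) by blast
      then have "nbhd E (g0 p) \<subseteq> X" using insideX by blast
      then show ?thesis using that(2) by auto
    qed
    have "card low - card X \<le> card (low - X)" by (rule diff_card_le_card_Diff[OF fX])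
    moreover have "card (K - P) \<le> card (VT - J)"
      using T.finite_V by (intro card_mono) (auto simp: K_def)
    ultimately show "card (K - P) + d \<le> card (low - X)" using J(5) X(3) by linarith
  qed
  then obtain f1 where f1: "packs F E V (P \<union> (K - P)) f1" "\<forall>p\<in>P. f1 p = g0 p" "f1 ` (K - P) \<subseteq> low - X"
    by blast
  have PKK: "P \<union> (K - P) = K" using PK by blast
  have f1P: "f1 ` P = insert v0 Q" using f1(2) g0P by (metis image_cong)
  have f1K: "f1 y \<in> low" if "y \<in> K" for y
  proof (cases "y \<in> P")
    case True
    then have "f1 y \<in> insert v0 Q" using f1P by blast
    then show ?thesis using insideX by blast
  next
    case False
    then show ?thesis using f1(3) that by blast
  qed
  have f1c: "f1 c = v0" using f1(2) by (simp add: P_def g0_def)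
  have QK: "Q \<subseteq> f1 ` K" using f1P PK by blast
  have nbJ: "nbhd F x \<subseteq> K" if "x \<in> J" for x
    using that J(3) T.edges_in by (auto simp: K_def indep_in_def)
  \<comment> \<open>Here the images of \<open>K\<close> are frozen to \<open>f1\<close>. All
    neighbours of \<open>J\<close> lie in \<open>K\<close>, so the conflicts of a vertex of
    \<open>J\<close> are the same in every state.\<close>
  define st where "st D f \<longleftrightarrow> K \<subseteq> D \<and> D \<subseteq> VT \<and> packs F E V D f \<and> (\<forall>y\<in>K. f y = f1 y)" for D f
  have "st (fst (K, f1)) (snd (K, f1))" using f1(1) PKK by (simp add: st_def K_def)
  moreover have "\<forall>y. st (fst y) (snd y) \<longrightarrow> card (fst y) < Suc n"
    using card_mono[OF T.finite_V] card_VT by (auto simp: st_def less_Suc_eq_le)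
  ultimately obtain Df where "st (fst Df) (snd Df)" and
    "\<forall>y. st (fst y) (snd y) \<longrightarrow> card (fst y) \<le> card (fst Df)"
    using ex_has_greatest_nat[of "\<lambda>y. st (fst y) (snd y)" "(K, f1)" "\<lambda>y. card (fst y)" "Suc n"]
    by blast
  then obtain D0 h0 where st0: "st D0 h0" and max: "\<And>D f. st D f \<Longrightarrow> card D \<le> card D0"
    by (metis fst_conv snd_conv)
  have stuck: "\<exists>y\<in>nbhd F x. (f1 y, u) \<in> E"
    if st: "st D f" "card D = card D0" and x: "x \<in> J" "x \<notin> D" and u: "u \<in> V - f ` D" for D f x u
  proof (rule ccontr)
    assume no: "\<not> ?thesis"
    have D: "K \<subseteq> D" "D \<subseteq> VT" "packs F E V D f" "\<And>y. y \<in> K \<Longrightarrow> f y = f1 y" using st by (auto simp: st_def)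
    have "packs F E V (insert x D) (f(x := u))"
    proof (rule extend[OF D(3) x(2)])
      show "u \<in> V" "u \<notin> f ` D" using u by auto
      show "(f y, u) \<notin> E" if "y \<in> D" "(x, y) \<in> F" for y
      proof -
        have "y \<in> K" using nbJ[OF x(1)] that by auto
        then show ?thesis using no that D(4)[of y] by auto
      qed
    qed
    then have "st (insert x D) (f(x := u))" using D x(1) J(2) by (auto simp: st_def K_def)
    from max[OF this] show False
      using st(2) x(2) finite_subset[OF D(2) T.finite_V] by simp
  qed
  have swap: "st (insert x0 (D - {x})) (f(x0 := f x)) \<and> card (insert x0 (D - {x})) = card D0 \<and>
      (f(x0 := f x)) ` insert x0 (D - {x}) = f ` D"
    if st: "st D f" "card D = card D0" and x0: "x0 \<in> J" "x0 \<notin> D" and x: "x \<in> J" "x \<in> D"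
      and free: "\<And>y. y \<in> nbhd F x0 \<Longrightarrow> (f1 y, f x) \<notin> E" for D f x0 x
  proof -
    have D: "K \<subseteq> D" "D \<subseteq> VT" "packs F E V D f" "\<And>y. y \<in> K \<Longrightarrow> f y = f1 y" using st by (auto simp: st_def)
    have "packs F E V (insert x0 (D - {x})) (f(x0 := f x))"
    proof (rule exchange[OF D(3) x0(2) x(2)])
      show "(f y, f x) \<notin> E" if "(x0, y) \<in> F" for y
      proof -
        have "y \<in> K" using nbJ[OF x0(1)] that by auto
        then show ?thesis using free[of y] D(4)[of y] that by simp
      qed
    qed
    then have "st (insert x0 (D - {x})) (f(x0 := f x))"
      using D x0 x J(2) by (auto simp: st_def K_def)
    moreover have "card (insert x0 (D - {x})) = card D0"
      using st(2) x0(2) x(2) finite_subset[OF D(2) T.finite_V] card_Suc_Diff1[of D x] by simp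
    moreover have "(f(x0 := f x)) ` insert x0 (D - {x}) = f ` D" using x0(2) x(2) by auto
    ultimately show ?thesis by blast
  qed
  define L where "L = leaves - P"
  have LJ: "L \<subseteq> J" using J(1) by (simp add: L_def)
  have fL: "finite L" using finite_leaves by (simp add: L_def)
  have cL: "card leaves \<le> card L + (k div 2 + 1)"
    using diff_card_le_card_Diff[OF fP, of leaves] cP by (simp add: L_def)
  have parent: "\<exists>p\<in>K. nbhd F x = {p}" if "x \<in> L" for x
  proof -
    have "card (nbhd F x) = 1" using that by (simp add: L_def leaves_def)
    then obtain p where "nbhd F x = {p}" by (rule card_1_singletonE)
    then show ?thesis using nbJ[of x] LJ that by blast
  qed
  have "D0 = VT"
  proof (rule ccontr)
    assume ne: "D0 \<noteq> VT"
    \<comment> \<open>An exchange makes the missing vertex a leaf, so that only the image of its one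
      neighbour obstructs it.\<close>
    have "\<exists>D f x. st D f \<and> card D = card D0 \<and> x \<in> L - D"
    proof (cases "L \<subseteq> D0")
      case False
      then show ?thesis using st0 by blast
    next
      case True
      obtain x0 where x0: "x0 \<in> VT" "x0 \<notin> D0" using ne st0 by (auto simp: st_def)
      then have x0J: "x0 \<in> J" using st0 by (auto simp: st_def K_def)
      have inj: "inj_on h0 D0" using st0 by (simp add: st_def packs_def)
      have "f1 ` nbhd F x0 \<subseteq> low" using f1K nbJ[OF x0J] by blast
      then have "card (\<Union>y\<in>nbhd F x0. nbhd E (f1 y)) \<le> card (nbhd F x0) * d"
        by (intro card_blocked) simp_all
      also have "\<dots> \<le> 2 * d" using J(4) x0J by (intro mult_right_mono) simp_all
      also have "\<dots> < card L" using cL many j by linarith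
      also have "card L = card (h0 ` L)"
        using inj_on_subset[OF inj True] by (simp add: card_image)
      finally have "\<not> h0 ` L \<subseteq> (\<Union>y\<in>nbhd F x0. nbhd E (f1 y))"
        by (meson T.finite_nbhd G.finite_nbhd card_mono finite_UN_I not_le)
      then obtain x where x: "x \<in> L" "h0 x \<notin> (\<Union>y\<in>nbhd F x0. nbhd E (f1 y))"
        by (meson image_subsetI)
      have "x \<in> D0" "x \<in> J" using x True LJ by auto
      then have "st (insert x0 (D0 - {x})) (h0(x0 := h0 x)) \<and> card (insert x0 (D0 - {x})) = card D0 \<and>
          (h0(x0 := h0 x)) ` insert x0 (D0 - {x}) = h0 ` D0"
        using x(2) by (intro swap[OF st0 refl x0J x0(2)]) simp_all
      moreover have "x \<in> L - insert x0 (D0 - {x})" using x(1) \<open>x \<in> D0\<close> x0(2) by auto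
      ultimately show ?thesis by blast
    qed
    then obtain D f x where st: "st D f" and cD: "card D = card D0" and x: "x \<in> L" "x \<notin> D" by blast
    have xJ: "x \<in> J" using x LJ by blast
    have D: "K \<subseteq> D" "D \<subseteq> VT" "packs F E V D f" "\<And>y. y \<in> K \<Longrightarrow> f y = f1 y" using st by (auto simp: st_def)
    obtain p where p: "p \<in> K" "nbhd F x = {p}" using parent[OF x(1)] by blast
    have f1D: "f1 ` K \<subseteq> f ` D"
    proof (rule image_subsetI)
      fix y assume "y \<in> K"
      then show "f1 y \<in> f ` D" using D(1) D(4)[of y] by (metis imageI subsetD)
    qed
    define U where "U = V - f ` D"
    have fU: "finite U" using G.finite_V by (simp add: U_def)
    have "D \<noteq> VT" using x(2) xJ J(2) by blast
    then have cU: "k div 2 \<le> card U" using card_unused[OF D(3,2)] by (simp add: U_def)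
    define A where "A = {y \<in> K. U \<subseteq> nbhd E (f1 y)}"
    have fA: "finite A" using T.finite_V by (simp add: A_def K_def)
    have f1inj: "inj_on f1 K" using f1(1) PKK by (simp add: packs_def)
    have cover: "(\<exists>y\<in>A. (y, x') \<in> F) \<or> x' \<in> D \<and> f x' \<in> nbhd E (f1 p)" if x': "x' \<in> L" for x'
    proof -
      have x'J: "x' \<in> J" using x' LJ by blast
      obtain y where y: "y \<in> K" "nbhd F x' = {y}" using parent[OF x'] by blast
      have yx: "(y, x') \<in> F" using y(2) T.edge_sym[of x' y] in_nbhd[of y F x'] by simp
      have "y \<in> A" if "\<not> (x' \<in> D \<and> f x' \<in> nbhd E (f1 p))"
      proof (cases "x' \<in> D")
        case False
        then have "(f1 y, u) \<in> E" if "u \<in> U" for u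
          using stuck[OF st cD x'J False, of u] that y(2) by (simp add: U_def)
        then show ?thesis using y(1) by (auto simp: A_def)
      next
        case True
        then have "(f1 p, f x') \<notin> E" using that by simp
        then have sw: "st (insert x (D - {x'})) (f(x := f x'))" "card (insert x (D - {x'})) = card D0"
          "(f(x := f x')) ` insert x (D - {x'}) = f ` D"
          using swap[OF st cD xJ x(2) x'J True] p(2) by simp_all
        have "x' \<notin> insert x (D - {x'})" using True x(2) by auto
        then have "(f1 y, u) \<in> E" if "u \<in> U" for u
          using stuck[OF sw(1,2) x'J, of u] that y(2) unfolding sw(3) by (simp add: U_def)
        then show ?thesis using y(1) by (auto simp: A_def)
      qed
      then show ?thesis using yx by blast
    qed
    \<comment> \<open>Otherwise \<open>U\<close> and the images of \<open>A\<close> span a complete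
      bipartite graph with room for a path on \<open>k\<close> vertices.\<close>
    have "card A < (k + 1) div 2"
    proof (rule ccontr)
      assume "\<not> ?thesis"
      then have "(k + 1) div 2 \<le> card (f1 ` A)"
        using card_image[OF inj_on_subset[OF f1inj], of A] by (simp add: A_def)
      moreover have "U \<inter> f1 ` A = {}" using f1D by (auto simp: U_def A_def)
      moreover have "(u, q) \<in> E \<and> (q, u) \<in> E" if "u \<in> U" "q \<in> f1 ` A" for u q
      proof -
        have "(q, u) \<in> E" using that by (auto simp: A_def)
        then show ?thesis using G.edge_sym by blast
      qed
      ultimately obtain xs where xs: "gpath E xs" "length xs = k" "set xs \<subseteq> U \<union> f1 ` A"
        using complete_bipartite_gpath[OF fU finite_imageI[OF fA] cU] by metis
      have "f1 ` A \<subseteq> V" using f1K low_subset by (auto simp: A_def)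
      then have "set xs \<subseteq> V" using xs(3) unfolding U_def by blast
      then show False using no_path[OF xs(1)] xs(2) by simp
    qed
    \<comment> \<open>The neighbours of \<open>v0\<close> in \<open>Q\<close> are occupied by
      \<open>I\<close>, and the fewer than \<open>k div 2\<close> others are too few for
      \<open>U\<close>.\<close>
    have cA: "c \<notin> A"
    proof
      assume "c \<in> A"
      then have "U \<subseteq> nbhd E v0" using f1c by (simp add: A_def)
      moreover have "U \<inter> Q = {}"
      proof -
        have "Q \<subseteq> f ` D" using QK f1D by blast
        then show ?thesis by (auto simp: U_def)
      qed
      ultimately have "U \<subseteq> nbhd E v0 - Q" by blast
      then have "card U \<le> card (nbhd E v0 - Q)" by (intro card_mono) auto
      then show False using v0(3) cU by simp
    qed
    define B where "B = {x' \<in> L. x' \<in> D \<and> f x' \<in> nbhd E (f1 p)}"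
    have cB: "card B \<le> d"
    proof -
      have "inj_on f B" using D(3) by (auto simp: B_def packs_def intro: inj_on_subset)
      then have "card B = card (f ` B)" by (simp add: card_image)
      also have "\<dots> \<le> card (nbhd E (f1 p))" by (intro card_mono) (auto simp: B_def)
      also have "\<dots> \<le> d" using f1K[OF p(1)] by (simp add: low_def)
      finally show ?thesis .
    qed
    have "nbhd F c \<inter> leaves \<subseteq> B"
    proof
      fix x' assume x': "x' \<in> nbhd F c \<inter> leaves"
      \<comment> \<open>A leaf at \<open>c\<close> is not in \<open>I\<close>, which consists of
        non-neighbours of \<open>c\<close>.\<close>
      then have "x' \<notin> P" using IR T.edge_irrefl[of c] by (auto simp: P_def R_def)
      then have x'L: "x' \<in> L" using x' by (simp add: L_def)
      obtain y where y: "nbhd F x' = {y}" using parent[OF x'L] by blast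
      have "c \<in> nbhd F x'" using x' T.edge_sym[of c x'] by simp
      then have "a = c" if "(a, x') \<in> F" for a using y that T.edge_sym[of a x'] in_nbhd[of a F x'] by auto
      then show "x' \<in> B" using cover[OF x'L] cA x'L by (auto simp: B_def)
    qed
    then have "lam c \<le> d" using cB card_mono[of B "nbhd F c \<inter> leaves"] fL by (simp add: lam_def B_def)
    then have lam_d: "lam y \<le> d" if "y \<in> VT" for y using lam_c[OF that] by linarith
    \<comment> \<open>Apart from the at most \<open>d\<close> leaves in \<open>B\<close>, all of
      \<open>L\<close> hangs on vertices of \<open>A\<close>, each carrying at most \<open>d\<close>
      leaves. The resulting bound \<open>2 * card L \<le> (k + 1) * d\<close> is too small for
      \<open>n \<le> 10 * card leaves\<close> and \<open>n \<ge> 20 * k\<^sup>2\<close>.\<close>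
    have "L \<subseteq> B \<union> (\<Union>y\<in>A. nbhd F y \<inter> leaves)"
      using cover by (fastforce simp: B_def L_def)
    then have "card L \<le> card (B \<union> (\<Union>y\<in>A. nbhd F y \<inter> leaves))"
      using fL fA by (intro card_mono) (simp_all add: B_def)
    also have "\<dots> \<le> card B + card (\<Union>y\<in>A. nbhd F y \<inter> leaves)" by (rule card_Un_le)
    also have "card (\<Union>y\<in>A. nbhd F y \<inter> leaves) \<le> (\<Sum>y\<in>A. lam y)"
      unfolding lam_def by (rule card_UN_le[OF fA])
    also have "(\<Sum>y\<in>A. lam y) \<le> card A * d"
      using sum_bounded_above[of A lam d] lam_d by (auto simp: A_def K_def)
    finally have "card L \<le> (card A + 1) * d" using cB by simp
    also have "\<dots> \<le> ((k + 1) div 2) * d"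
      using \<open>card A < (k + 1) div 2\<close> by (intro mult_right_mono) auto
    finally have "2 * card L \<le> (2 * ((k + 1) div 2)) * d" by simp
    also have "\<dots> \<le> (k + 1) * d" by (intro mult_right_mono) auto
    finally have "2 * card L \<le> 4 * (j * j) + 12 * j" using j by (simp add: algebra_simps)
    then show False using cL many j by linarith
  qed
  then show ?thesis using st0 by (auto simp: st_def)
qed

section \<open>The Ramsey number\<close>

lemma pair_wf_path_graph: "pair_wf_digraph (path_graph k)"
  by (auto simp: path_graph_def pair_wf_digraph_def)

lemma pair_wf_complement: "pair_wf_digraph (complement_graph G)"
  by (auto simp: complement_graph_def pair_wf_digraph_def)

lemma gpath_contains_path_graph:
  assumes "pair_wf_digraph G" and sym: "\<And>u v. (u, v) \<in> parcs G \<Longrightarrow> (v, u) \<in> parcs G"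
    and xs: "gpath (parcs G) xs" "set xs \<subseteq> pverts G" "k \<le> length xs"
  shows "contains_subgraph G (path_graph k)"
  unfolding contains_subgraph_iff_embedding[OF assms(1) pair_wf_path_graph]
proof (intro exI[of _ "\<lambda>i. xs ! i"] conjI allI impI)
  show "inj_on (\<lambda>i. xs ! i) (pverts (path_graph k))"
    using xs by (auto simp: path_graph_def gpath_def inj_on_def nth_eq_iff_index_eq)
  show "(\<lambda>i. xs ! i) ` pverts (path_graph k) \<subseteq> pverts G"
    using xs(2,3) nth_mem by (fastforce simp: path_graph_def)
  have step: "(xs ! i, xs ! Suc i) \<in> parcs G" if "Suc i < k" for i
    using xs that by (simp add: gpath_def successively_conv_nth)
  fix u v assume "(u, v) \<in> parcs (path_graph k)"
  then consider "v = Suc u" "v < k" | "u = Suc v" "u < k" by (auto simp: path_graph_def)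
  then show "(xs ! u, xs ! v) \<in> parcs G" by cases (use step sym in auto)
qed

text \<open>With the complement of \<open>\<Gamma>\<close> as the graph to be avoided, a packing of
  the whole tree is a copy of it in \<open>\<Gamma>\<close>.\<close>

lemma ramsey_property_tree_path:
  assumes k: "k \<ge> 2" and n: "n \<ge> 20 * k\<^sup>2" and T: "tree_graph T"
    and cT: "card (pverts T) = n" and deg: "max_degree T < n - k"
  shows "ramsey_property T (path_graph k) (n + k div 2 - 1)"
  unfolding ramsey_property_def
proof (intro allI impI)
  fix \<Gamma> :: "nat pair_pre_digraph"
  assume \<Gamma>: "pair_graph \<Gamma> \<and> card (pverts \<Gamma>) = n + k div 2 - 1"
  let ?C = "complement_graph \<Gamma>"
  have T': "pair_graph T" using T by (simp add: tree_graph_def)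
  interpret tree: forest_graph "pverts T" "parcs T" by (rule tree_graph_forest[OF T])
  interpret gam: simple_graph "pverts \<Gamma>" "parcs \<Gamma>" using \<Gamma> by (simp add: pair_graph_simple_graph)
  have vC: "pverts ?C = pverts \<Gamma>" by (simp add: complement_graph_def)
  have aC: "(u, v) \<in> parcs ?C \<longleftrightarrow> u \<in> pverts \<Gamma> \<and> v \<in> pverts \<Gamma> \<and> u \<noteq> v \<and> (u, v) \<notin> parcs \<Gamma>" for u v
    by (simp add: complement_graph_def)
  have symC: "(v, u) \<in> parcs ?C" if "(u, v) \<in> parcs ?C" for u v
    using that gam.edge_sym[of v u] by (auto simp: aC)
  show "contains_subgraph \<Gamma> T \<or> contains_subgraph ?C (path_graph k)"
  proof (rule disjCI)
    assume noP: "\<not> contains_subgraph ?C (path_graph k)"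
    interpret C: simple_graph "pverts \<Gamma>" "parcs ?C"
    proof
      show "finite (pverts \<Gamma>)" by (rule gam.finite_V)
      show "u \<in> pverts \<Gamma> \<and> v \<in> pverts \<Gamma>" if "(u, v) \<in> parcs ?C" for u v using that by (simp add: aC)
      show "(v, u) \<in> parcs ?C" if "(u, v) \<in> parcs ?C" for u v using symC[OF that] .
      show "(v, v) \<notin> parcs ?C" for v by (simp add: aC)
    qed
    have "1 \<le> k div 2" using k by simp
    then have cV: "card (pverts \<Gamma>) + 1 = n + k div 2" using \<Gamma> by linarith
    interpret packing_setting "pverts T" "parcs T" "pverts \<Gamma>" "parcs ?C" k n
    proof
      show "2 \<le> k" "20 * k\<^sup>2 \<le> n" "card (pverts T) = n" "card (pverts \<Gamma>) + 1 = n + k div 2"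
        by (fact k n cT cV)+
      show "length xs < k" if "gpath (parcs ?C) xs" "set xs \<subseteq> pverts \<Gamma>" for xs
        using gpath_contains_path_graph[OF pair_wf_complement symC that(1), of k] that(2) noP
        unfolding vC by (meson not_less)
      show "\<exists>u\<in>S. \<exists>v\<in>pverts T - S. (u, v) \<in> parcs T"
        if "S \<subseteq> pverts T" "S \<noteq> {}" "S \<noteq> pverts T" for S
        using tree_graph_edge_leaving[OF T that] .
      show "card (nbhd (parcs T) v) < n - k" if v: "v \<in> pverts T" for v
      proof -
        have "out_degree (with_proj T) v = card (nbhd (parcs T) v)"
        proof -
          have "out_arcs (with_proj T) v = Pair v ` nbhd (parcs T) v"
            by (auto simp: out_arcs_def)
          then show ?thesis by (simp add: out_degree_def card_image inj_on_def)
        qed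
        moreover have "out_degree (with_proj T) v \<le> max_degree T"
          unfolding max_degree_def using v tree.finite_V by (intro Max_ge) auto
        ultimately show ?thesis using deg by simp
      qed
    qed
    obtain f where f: "packs (parcs T) (parcs ?C) (pverts \<Gamma>) (pverts T) f"
      using few_leaves_packing many_leaves_packing by (meson not_le)
    have "(f u, f v) \<in> parcs \<Gamma>" if "(u, v) \<in> parcs T" for u v
    proof -
      have uv: "u \<in> pverts T" "v \<in> pverts T" "u \<noteq> v"
        using that tree.edges_in tree.edge_irrefl by blast+
      then have "f u \<noteq> f v" "f u \<in> pverts \<Gamma>" "f v \<in> pverts \<Gamma>" "(f u, f v) \<notin> parcs ?C"
        using f that by (auto simp: packs_def inj_on_def)
      then show ?thesis by (simp add: aC)
    qed
    moreover have "pair_wf_digraph \<Gamma>" "pair_wf_digraph T"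
      using gam.edges_in tree.edges_in by (auto simp: pair_wf_digraph_def)
    ultimately show "contains_subgraph \<Gamma> T"
      using f by (subst contains_subgraph_iff_embedding) (auto simp: packs_def)
  qed
qed

text \<open>The witness for the lower bound is the disjoint union of a complete graph on \<^term>\<open>n - 1\<close>
  vertices and one on fewer than \<^term>\<open>k div 2\<close> vertices.\<close>
lemma not_ramsey_property_tree_path:
  assumes k: "k \<ge> 2" and T: "tree_graph T" and cT: "card (pverts T) = n" and kn: "k div 2 \<le> n"
    and N: "N + 1 < n + k div 2"
  shows "\<not> ramsey_property T (path_graph k) N"
proof
  assume R: "ramsey_property T (path_graph k) N"
  define \<Gamma> :: "nat pair_pre_digraph" where
    "\<Gamma> = \<lparr> pverts = {..<N}, parcs = {(u, v). u < N \<and> v < N \<and> u \<noteq> v \<and> (u < n - 1 \<longleftrightarrow> v < n - 1)} \<rparr>"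
  have "pair_graph \<Gamma>"
  proof
    show "finite (parcs \<Gamma>)"
      by (rule finite_subset[of _ "{..<N} \<times> {..<N}"]) (auto simp: \<Gamma>_def)
  qed (auto simp: \<Gamma>_def symmetric_def sym_def)
  moreover have "card (pverts \<Gamma>) = N" by (simp add: \<Gamma>_def)
  ultimately have "contains_subgraph \<Gamma> T \<or> contains_subgraph (complement_graph \<Gamma>) (path_graph k)"
    using R unfolding ramsey_property_def by blast
  then show False
  proof
    assume "contains_subgraph \<Gamma> T"
    interpret tree: forest_graph "pverts T" "parcs T" by (rule tree_graph_forest[OF T])
    have "pair_wf_digraph \<Gamma>" "pair_wf_digraph T"
      using tree.edges_in by (auto simp: pair_wf_digraph_def \<Gamma>_def)
    then obtain f where f: "inj_on f (pverts T)" "f ` pverts T \<subseteq> {..<N}"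
      "\<And>u v. (u, v) \<in> parcs T \<Longrightarrow> (f u < n - 1 \<longleftrightarrow> f v < n - 1)"
      using \<open>contains_subgraph \<Gamma> T\<close> contains_subgraph_iff_embedding[of \<Gamma> T]
      by (auto simp: \<Gamma>_def)
    define S where "S = {v \<in> pverts T. f v < n - 1}"
    \<comment> \<open>Connectedness puts the whole tree into one of the two cliques.\<close>
    have "S = {} \<or> S = pverts T"
      using tree_graph_edge_leaving[OF T, of S] f(3) by (auto simp: S_def)
    moreover have "card (f ` pverts T) = n" using f(1) cT by (simp add: card_image)
    moreover have "card (f ` pverts T) \<le> n - 1" if "S = pverts T"
      using card_mono[of "{..<n - 1}" "f ` pverts T"] that by (auto simp: S_def)
    \<comment> \<open>The second clique has fewer than \<open>k div 2\<close> vertices, too few for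
      the tree because \<open>k div 2 \<le> n\<close>.\<close>
    moreover have "card (f ` pverts T) \<le> N - (n - 1)" if "S = {}"
      using card_mono[of "{n - 1..<N}" "f ` pverts T"] that f(2) by (fastforce simp: S_def not_less)
    ultimately show False using N kn k by fastforce
  next
    assume "contains_subgraph (complement_graph \<Gamma>) (path_graph k)"
    then obtain f where f: "inj_on f {..<k}" "f ` {..<k} \<subseteq> {..<N}"
      "\<And>u v. (u, v) \<in> parcs (path_graph k) \<Longrightarrow> (f u, f v) \<in> parcs (complement_graph \<Gamma>)"
      using contains_subgraph_iff_embedding[OF pair_wf_complement pair_wf_path_graph, of \<Gamma> k]
      by (auto simp: \<Gamma>_def complement_graph_def path_graph_def)
    have edge: "n - 1 \<le> f i \<or> n - 1 \<le> f (Suc i)" if "Suc i < k" for i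
      using f(3)[of i "Suc i"] that by (auto simp: \<Gamma>_def complement_graph_def path_graph_def)
    \<comment> \<open>The first clique is independent in the complement, so one of the path vertices
      \<open>2 * i\<close> and \<open>2 * i + 1\<close> falls into the second; \<open>g\<close>
      selects it. That gives \<open>k div 2\<close> distinct vertices there, one too many.\<close>
    define g where "g i = (if n - 1 \<le> f (2 * i) then 2 * i else Suc (2 * i))" for i
    have gk: "g i < k \<and> n - 1 \<le> f (g i)" if "i < k div 2" for i
    proof -
      have "Suc (2 * i) < k" using that by linarith
      then show ?thesis using edge[of "2 * i"] by (auto simp: g_def)
    qed
    have ginj: "i = i'" if "g i = g i'" for i i'
      using that unfolding g_def by (auto split: if_splits; presburger)
    have "inj_on (\<lambda>i. f (g i)) {..<k div 2}"
      using gk f(1) ginj by (auto simp: inj_on_def)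
    then have "card ((\<lambda>i. f (g i)) ` {..<k div 2}) = k div 2" by (simp add: card_image)
    moreover have "(\<lambda>i. f (g i)) ` {..<k div 2} \<subseteq> {n - 1..<N}"
    proof (rule image_subsetI)
      fix i assume "i \<in> {..<k div 2}"
      then have "g i \<in> {..<k}" "n - 1 \<le> f (g i)" using gk[of i] by simp_all
      then show "f (g i) \<in> {n - 1..<N}" using f(2) by auto
    qed
    then have "card ((\<lambda>i. f (g i)) ` {..<k div 2}) \<le> N - (n - 1)"
      using card_mono[of "{n - 1..<N}"] by fastforce
    ultimately show False using N k by linarith
  qed
qed

theorem corollary1p4:
  fixes k n :: nat and T :: "'a pair_pre_digraph"
  assumes "k \<ge> 2"
    and "n \<ge> 20 * k^2"
    and "tree_graph T"
    and "card (pverts T) = n"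
    and "max_degree T < n - k"
  shows "ramsey_number T (path_graph k) = n + k div 2 - 1"
  unfolding ramsey_number_def
proof (rule Least_equality)
  have "k div 2 \<le> n" "1 \<le> n"
  proof -
    have "k \<le> k\<^sup>2" by (simp add: power2_eq_square)
    then show "k div 2 \<le> n" "1 \<le> n" using assms(1,2) by linarith+
  qed
  then show "0 < n + k div 2 - 1 \<and> ramsey_property T (path_graph k) (n + k div 2 - 1)"
    using ramsey_property_tree_path[OF assms] assms(1) by simp
  show "n + k div 2 - 1 \<le> N" if "0 < N \<and> ramsey_property T (path_graph k) N" for N
    using not_ramsey_property_tree_path[OF assms(1,3,4) \<open>k div 2 \<le> n\<close>, of N] that by linarith
qed

end
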